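(* Let $\mathbb V,\mathbb W\subset \operatorname{Rad}(kE)$ be two linear subspaces each of which is a splitting of the projection $\operatorname{Rad}(kE)\to\operatorname{Rad}(kE)/\operatorname{Rad}^2(kE)$, and let $\psi:\mathbb V\to\mathbb W$ be the unique isomorphism commuting with the projection isomorphisms to $\operatorname{Rad}(kE)/\operatorname{Rad}^2(kE)$. Let $1\le r\le n$, let $\Psi:\operatorname{Grass}(r,\mathbb V)\to\operatorname{Grass}(r,\mathbb W)$, $U\mapsto\psi(U)$, be the induced isomorphism of Grassmannians, and let $M$ be a finite dimensional $kE$-module. Then $\Psi$ restricts to an isomorphism $$\operatorname{Grass}(r,\mathbb V)_M\ \xrightarrow{\ \sim\ }\ \operatorname{Grass}(r,\mathbb W)_M.$$
   Context: $k$ is an algebraically closed field of characteristic $p>0$, $E$ is an elementary abelian $p$-group of rank $n\ge1$, and $kE\cong k[x_1,\dots,x_n]/(x_1^p,\dots,x_n^p)$ is its group algebra with Jacobson radical $\operatorname{Rad}(kE)$. A subspace $\mathbb V\subset\operatorname{Rad}(kE)$ is a splitting of the projection $\operatorname{Rad}(kE)\to\operatorname{Rad}(kE)/\operatorname{Rad}^2(kE)$ if the composition $\mathbb V\hookrightarrow\operatorname{Rad}(kE)\to\operatorname{Rad}(kE)/\operatorname{Rad}^2(kE)$ is an isomorphism of vector spaces; this gives an identification $S^*(\mathbb V)/\langle v^p, v\in\mathbb V\rangle\cong kE$. $\operatorname{Grass}(r,\mathbb V)$ is the Grassmann variety of $r$-dimensional linear subspaces of $\mathbb V$. For $U\in\operatorname{Grass}(r,\mathbb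 V)$ set $C(U)=S^*(U)/\langle u^p,u\in U\rangle\cong k[t_1,\dots,t_r]/(t_1^p,\dots,t_r^p)$ and let $\alpha_U:C(U)\to kE$ be the $k$-algebra map induced by the inclusion $U\subset\mathbb V$; $\alpha_U^*(M)$ denotes the restriction of $M$ along $\alpha_U$. The $r$-rank variety $\operatorname{Grass}(r,\mathbb V)_M\subset\operatorname{Grass}(r,\mathbb V)$ is the (closed) subset of those $U$ such that $\alpha_U^*(M)$ is not a free $C(U)$-module; $\operatorname{Grass}(r,\mathbb W)_M$ is defined in the same way with $\mathbb W$ in place of $\mathbb V$. *)

theory Defs
  imports
    "HOL-Library.Poly_Mapping"
    "HOL-Algebra.Algebra"
    "HOL-Analysis.Abstract_Topology"
    "HOL-Analysis.Function_Topology"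
    "Jordan_Normal_Form.Determinant"
begin

section \<open>The group algebra\<close>

text \<open>
  The group is written additively and is the whole type \<open>'e\<close>. Its group algebra over \<open>'k\<close> is the
  type \<open>'e \<Rightarrow>\<^sub>0 'k\<close> of finitely supported functions, whose library multiplication is convolution.
\<close>

type_synonym ('e, 'k) group_algebra = "'e \<Rightarrow>\<^sub>0 'k"

definition elementary_abelian :: "'e::ab_group_add itself \<Rightarrow> nat \<Rightarrow> nat \<Rightarrow> bool" where
  "elementary_abelian _ p n \<longleftrightarrow>
     \<lparr>carrier = (UNIV :: 'e set), monoid.mult = (+), monoid.one = 0\<rparr>
       \<cong> product_group {..<n} (\<lambda>_. integer_mod_group p)"

definition kE :: "('e::ab_group_add, 'k::field) group_algebra ring" where
  "kE = \<lparr>carrier = UNIV, monoid.mult = (*), monoid.one = 1, ring.zero = 0, ring.add = (+)\<rparr>"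

definition scalar :: "'k::field \<Rightarrow> ('e::ab_group_add, 'k) group_algebra" where
  "scalar c = Poly_Mapping.single 0 c"

definition gscale :: "'k::field \<Rightarrow> ('e::ab_group_add, 'k) group_algebra \<Rightarrow> ('e, 'k) group_algebra" where
  "gscale c x = scalar c * x"

lemma vector_space_gscale: "vector_space gscale"
  by unfold_locales
    (simp_all add: gscale_def scalar_def algebra_simps single_add mult_single)

definition Rad :: "('e::ab_group_add, 'k::field) group_algebra set" where
  "Rad = \<Inter> {I. maximalideal I kE}"

definition Rad2 :: "('e::ab_group_add, 'k::field) group_algebra set" where
  "Rad2 = ideal_prod kE Rad Rad"

definition proj :: "('e::ab_group_add, 'k::field) group_algebra \<Rightarrow> ('e, 'k) group_algebra set" where
  "proj x = Rad2 +>\<^bsub>kE\<^esub> x"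

text \<open>
  The vector space structure of \<open>Rad / Rad2\<close> is the one for which \<open>proj\<close> is linear, so the
  composite \<open>V \<rightarrow> Rad \<rightarrow> Rad / Rad2\<close> is an isomorphism as soon as it is bijective.
\<close>

definition splitting :: "('e::ab_group_add, 'k::field) group_algebra set \<Rightarrow> bool" where
  "splitting V \<longleftrightarrow> module.subspace gscale V \<and> V \<subseteq> Rad \<and> bij_betw proj V (proj ` Rad)"

definition linear_map_on ::
  "'a::ab_group_add set \<Rightarrow> ('k \<Rightarrow> 'a \<Rightarrow> 'a) \<Rightarrow> ('k \<Rightarrow> 'b::ab_group_add \<Rightarrow> 'b) \<Rightarrow> ('a \<Rightarrow> 'b) \<Rightarrow> bool" where
  "linear_map_on V s t f \<longleftrightarrow>
     (\<forall>x\<in>V. \<forall>y\<in>V. f (x + y) = f x + f y) \<and> (\<forall>c. \<forall>x\<in>V. f (s c x) = t c (f x))"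

section \<open>The algebra \<open>C(U)\<close> and restriction along \<open>\<alpha>\<^sub>U\<close>\<close>

text \<open>
  The symmetric algebra of \<open>U\<close> is the polynomial ring over \<open>'k\<close> with one variable for every vector
  of \<open>U\<close>, modulo the relations making \<open>u \<mapsto> Var u\<close> linear.
\<close>

type_synonym ('a, 'k) mpoly = "('a \<Rightarrow>\<^sub>0 nat) \<Rightarrow>\<^sub>0 'k"

definition poly_ring :: "'a set \<Rightarrow> ('a, 'k::field) mpoly ring" where
  "poly_ring U = \<lparr>carrier = {f. \<forall>m \<in> Poly_Mapping.keys f. Poly_Mapping.keys m \<subseteq> U},
     monoid.mult = (*), monoid.one = 1, ring.zero = 0, ring.add = (+)\<rparr>"

definition Var :: "'a \<Rightarrow> ('a, 'k::field) mpoly" where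
  "Var u = Poly_Mapping.single (Poly_Mapping.single u 1) 1"

definition Const :: "'k \<Rightarrow> ('a, 'k::field) mpoly" where
  "Const c = Poly_Mapping.single 0 c"

definition sym_ideal ::
  "('e::ab_group_add, 'k::field) group_algebra set \<Rightarrow> (('e, 'k) group_algebra, 'k) mpoly set" where
  "sym_ideal U = genideal (poly_ring U)
     ({Var (u + v) - (Var u + Var v) | u v. u \<in> U \<and> v \<in> U} \<union>
      {Var (gscale c u) - Const c * Var u | c u. u \<in> U})"

definition sym_algebra ::
  "('e::ab_group_add, 'k::field) group_algebra set \<Rightarrow> (('e, 'k) group_algebra, 'k) mpoly set ring" where
  "sym_algebra U = poly_ring U Quot sym_ideal U"

definition sym_incl ::
  "('e::ab_group_add, 'k::field) group_algebra set \<Rightarrow> ('e, 'k) group_algebra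
     \<Rightarrow> (('e, 'k) group_algebra, 'k) mpoly set" where
  "sym_incl U u = sym_ideal U +>\<^bsub>poly_ring U\<^esub> Var u"

definition C ::
  "nat \<Rightarrow> ('e::ab_group_add, 'k::field) group_algebra set
     \<Rightarrow> (('e, 'k) group_algebra, 'k) mpoly set set ring" where
  "C p U = sym_algebra U Quot
     genideal (sym_algebra U) ((\<lambda>u. sym_incl U u [^]\<^bsub>sym_algebra U\<^esub> p) ` U)"

definition eval_poly ::
  "(('e::ab_group_add, 'k::field) group_algebra, 'k) mpoly \<Rightarrow> ('e, 'k) group_algebra" where
  "eval_poly f = (\<Sum>m \<in> Poly_Mapping.keys f. scalar (Poly_Mapping.lookup f m) *
     (\<Prod>u \<in> Poly_Mapping.keys m. u ^ Poly_Mapping.lookup m u))"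

text \<open>
  An element \<open>z\<close> of \<open>C p U\<close> is a coset of cosets, and \<open>\<Union> z\<close> is the set of all polynomials
  representing it. On these the evaluation \<open>Var u \<mapsto> u\<close> is constant when \<open>u ^ p = 0\<close> on \<open>U\<close> (as it is
  for \<open>U \<subseteq> Rad\<close>); its value is the image of \<open>z\<close> under the induced map \<open>\<alpha>\<^sub>U\<close>.
\<close>

definition alpha ::
  "(('e::ab_group_add, 'k::field) group_algebra, 'k) mpoly set set \<Rightarrow> ('e, 'k) group_algebra" where
  "alpha z = the_elem (eval_poly ` \<Union> z)"

text \<open>
  A module over the group algebra is a type \<open>'m\<close> with an action satisfying the locale
  \<open>Modules.module\<close>. The multiplicative fields of the record below play no role.
\<close>

definition restriction ::
  "(('e::ab_group_add, 'k::field) group_algebra \<Rightarrow> 'm::ab_group_add \<Rightarrow> 'm)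
     \<Rightarrow> ((('e, 'k) group_algebra, 'k) mpoly set set, 'm) module" where
  "restriction act = \<lparr>carrier = UNIV, monoid.mult = undefined, monoid.one = undefined, ring.zero = 0, ring.add = (+),
     module.smult = (\<lambda>z x. act (alpha z) x)\<rparr>"

definition free_module :: "('a, 'c) ring_scheme \<Rightarrow> ('a, 'm, 'd) module_scheme \<Rightarrow> bool" where
  "free_module R N \<longleftrightarrow> (\<exists>B \<subseteq> carrier N. \<forall>x \<in> carrier N.
     \<exists>!c. c \<in> B \<rightarrow>\<^sub>E carrier R \<and> finite {b \<in> B. c b \<noteq> \<zero>\<^bsub>R\<^esub>} \<and>
       x = (\<Oplus>\<^bsub>N\<^esub>b \<in> {b \<in> B. c b \<noteq> \<zero>\<^bsub>R\<^esub>}. c b \<odot>\<^bsub>N\<^esub> b))"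

section \<open>Grassmannians\<close>

definition Grass ::
  "nat \<Rightarrow> ('e::ab_group_add, 'k::field) group_algebra set \<Rightarrow> ('e, 'k) group_algebra set set" where
  "Grass r V = {U. module.subspace gscale U \<and> U \<subseteq> V \<and> vector_space.dim gscale U = r}"

definition rank_variety ::
  "nat \<Rightarrow> nat \<Rightarrow> ('e::ab_group_add, 'k::field) group_algebra set
     \<Rightarrow> (('e, 'k) group_algebra \<Rightarrow> 'm::ab_group_add \<Rightarrow> 'm) \<Rightarrow> ('e, 'k) group_algebra set set" where
  "rank_variety p r V act = {U \<in> Grass r V. \<not> free_module (C p U) (restriction act)}"

definition frame ::
  "nat \<Rightarrow> ('e::ab_group_add, 'k::field) group_algebra set \<Rightarrow> (nat \<Rightarrow> ('e, 'k) group_algebra) \<Rightarrow> bool" where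
  "frame r U u \<longleftrightarrow> inj_on u {..<r} \<and> \<not> module.dependent gscale (u ` {..<r}) \<and>
     module.span gscale (u ` {..<r}) = U"

text \<open>
  Coordinate-free description of the Pluecker embedding of \<open>Grass r V\<close>. For linear functionals
  \<open>l 0, \<dots>, l (r - 1)\<close> on \<open>V\<close>, the function \<open>u \<mapsto> det (l i (u j))\<close> on frames is a linear form on the
  \<open>r\<close>-th exterior power of \<open>V\<close>, evaluated at the Pluecker vector \<open>u 0 \<and> \<dots> \<and> u (r - 1)\<close>; such forms
  span all linear forms. \<open>plucker_form r V d\<close> consists of the homogeneous polynomials of degree
  \<open>d\<close> in them. Changing the frame of a fixed subspace multiplies all forms of degree \<open>d\<close> by the
  same nonzero scalar.
\<close>

inductive plucker_form ::
  "nat \<Rightarrow> ('e::ab_group_add, 'k::field) group_algebra set \<Rightarrow> nat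
     \<Rightarrow> ((nat \<Rightarrow> ('e, 'k) group_algebra) \<Rightarrow> 'k) \<Rightarrow> bool" for r V where
  const: "plucker_form r V 0 (\<lambda>_. c)"
| add: "plucker_form r V d F \<Longrightarrow> plucker_form r V d G \<Longrightarrow> plucker_form r V d (\<lambda>u. F u + G u)"
| coord: "(\<And>i. i < r \<Longrightarrow> linear_map_on V gscale (*) (l i)) \<Longrightarrow> plucker_form r V d F \<Longrightarrow>
    plucker_form r V (Suc d) (\<lambda>u. Determinant.det (mat r r (\<lambda>(i, j). l i (u j))) * F u)"

definition grass_topology ::
  "nat \<Rightarrow> ('e::ab_group_add, 'k::field) group_algebra set \<Rightarrow> ('e, 'k) group_algebra set topology" where
  "grass_topology r V = topology_generated_by
     {{U \<in> Grass r V. \<exists>u. frame r U u \<and> F u \<noteq> 0} | d F. plucker_form r V d F}"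

text \<open>
  A subset \<open>A\<close> of \<open>Grass r V\<close> carries the subspace topology and the sheaf of functions which are
  locally quotients of forms of equal degree; for closed \<open>A\<close> this is the reduced closed subvariety.
\<close>

definition regular_on ::
  "nat \<Rightarrow> ('e::ab_group_add, 'k::field) group_algebra set \<Rightarrow> ('e, 'k) group_algebra set set
     \<Rightarrow> ('e, 'k) group_algebra set set \<Rightarrow> (('e, 'k) group_algebra set \<Rightarrow> 'k) \<Rightarrow> bool" where
  "regular_on r V A S f \<longleftrightarrow> (\<forall>U\<in>S. \<exists>N d F G.
     openin (subtopology (grass_topology r V) A) N \<and> U \<in> N \<and> N \<subseteq> S \<and>
     plucker_form r V d F \<and> plucker_form r V d G \<and>
     (\<forall>U'\<in>N. \<forall>u. frame r U' u \<longrightarrow> G u \<noteq> 0 \<and> f U' = F u / G u))"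

definition variety_iso ::
  "nat \<Rightarrow> ('e::ab_group_add, 'k::field) group_algebra set \<Rightarrow> ('e, 'k) group_algebra set set
     \<Rightarrow> ('e, 'k) group_algebra set \<Rightarrow> ('e, 'k) group_algebra set set
     \<Rightarrow> (('e, 'k) group_algebra set \<Rightarrow> ('e, 'k) group_algebra set) \<Rightarrow> bool" where
  "variety_iso r V A W B \<phi> \<longleftrightarrow>
     homeomorphic_map (subtopology (grass_topology r V) A) (subtopology (grass_topology r W) B) \<phi> \<and>
     (\<forall>S f. openin (subtopology (grass_topology r W) B) S \<longrightarrow>
        (regular_on r W B S f \<longleftrightarrow> regular_on r V A {U \<in> A. \<phi> U \<in> S} (\<lambda>U. f (\<phi> U))))"

end

theory Submission
  imports Defs
begin

text \<open>
  Let \<open>u\<^sub>1, \<dots>, u\<^sub>r\<close> be a basis of \<open>U\<close>. Since \<open>C p U\<close> is a local Frobenius algebra with socle spanned by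
  \<open>u\<^sub>1\<^sup>p\<^sup>-\<^sup>1 \<cdots> u\<^sub>r\<^sup>p\<^sup>-\<^sup>1\<close>, a module is free over it iff every element killed by this product lies in
  \<open>u\<^sub>1 M + \<dots> + u\<^sub>r M\<close>. This criterion is symmetric in the \<open>u\<^sub>i\<close>, and it holds iff it holds for all but
  one of them and \<open>ker u\<^sup>p\<^sup>-\<^sup>1 = im u\<close> for the remaining \<open>u\<close> on the quotient of \<open>M\<close> by the images of
  the others. The latter condition is unchanged when \<open>u\<close> is replaced by \<open>u + f g\<close> with
  \<open>f\<^sup>p = g\<^sup>p = 0\<close>, hence also by \<open>u + c\<close> with \<open>c\<close> in the square of the radical. So the basis can
  be exchanged for its image under \<open>\<psi>\<close> one vector at a time. The induced map of Grassmannians is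
  an isomorphism because Pluecker forms pull back along \<open>\<psi>\<close> and its inverse.
\<close>

section \<open>Perturbing nilpotent operators\<close>

text \<open>The algebras attached to \<open>U\<close> and to its image are isomorphic, but in
  general the isomorphism does not respect their actions on the module, so only conditions on single
  operators can be compared; the socle criterion splits freeness into such conditions. During the
  exchange the quotient is by images of a mixture of old and new vectors. The condition on one
  vector is therefore stated relative to an arbitrary submodule \<open>J\<close>, and no quotient
  module is formed. Elements of the square of the radical are reached through products
  \<open>g * f\<close> because every radical element has vanishing p-th power: taking p-th powers is
  additive and sends each group element to the identity. The criterion itself is proved on
  polynomials. \<open>C p U\<close> is a quotient of a quotient of a ring with one variable for each
  vector, so its elements are represented by polynomials modulo the kernel \<open>C_ker\<close>,
  with representatives in basis variables and all exponents below \<open>p\<close>. What keeps this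
  quotient from collapsing is that the socle monomial is not in the kernel.\<close>

lemma perturbation_cofactor:
  fixes x f g :: "'a::comm_ring_1"
  assumes p: "Factorial_Ring.prime p" "of_nat p = (0 :: 'a)" and f: "f ^ p = 0"
  obtains h where "(x + g * f) ^ (p - 1) = x ^ (p - 1) + g * h"
    and "x * h + f * (x + g * f) ^ (p - 1) = 0"
proof -
  have p1: "p > 1" using p(1) prime_gt_1_nat by blast
  then obtain q where q: "p = Suc (Suc q)"
    by (metis One_nat_def Suc_lessE less_natE)
  define t where "t k = x ^ (q - k) * f ^ Suc k * g ^ k" for k
  \<comment> \<open>Formally, \<open>g * (x * h + f * (x + g * f) ^ (p - 1))\<close> is
    \<open>(x + g * f) ^ p - x ^ p = g ^ p * f ^ p\<close>, and dividing by \<open>g\<close> leaves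
    a multiple of \<open>f ^ p\<close>. As \<open>g\<close> may be a zero divisor, the divided
    identity is checked on coefficients: Pascal's rule merges the two sums into binomials
    \<open>p choose Suc k\<close>.\<close>
  define h where "h = (\<Sum>k\<le>q. of_nat (Suc q choose Suc k) * t k)"
  have D: "(x + g * f) ^ Suc q =
      (\<Sum>k\<le>Suc q. of_nat (Suc q choose k) * (g * f) ^ k * x ^ (Suc q - k))"
    by (subst add.commute) (rule binomial_ring)
  also have "\<dots> = x ^ Suc q +
      (\<Sum>k\<le>q. of_nat (Suc q choose Suc k) * (g * f) ^ Suc k * x ^ (q - k))"
    by (subst sum.atMost_Suc_shift) simp
  also have "(\<Sum>k\<le>q. of_nat (Suc q choose Suc k) * (g * f) ^ Suc k * x ^ (q - k)) = g * h"
    unfolding h_def sum_distrib_left t_def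
    by (rule sum.cong) (simp_all add: power_mult_distrib algebra_simps del: binomial_Suc_Suc)
  finally have 1: "(x + g * f) ^ Suc q = x ^ Suc q + g * h" .
  have xt: "x * t k = x ^ (Suc q - k) * f ^ Suc k * g ^ k" if "k \<le> q" for k
    using that by (simp add: t_def Suc_diff_le algebra_simps)
  have "f * (x + g * f) ^ Suc q =
      (\<Sum>k\<le>Suc q. of_nat (Suc q choose k) * (x ^ (Suc q - k) * f ^ Suc k * g ^ k))"
    unfolding D sum_distrib_left
    by (rule sum.cong) (simp_all add: power_mult_distrib algebra_simps del: binomial_Suc_Suc)
  \<comment> \<open>The top term \<open>k = Suc q\<close> contains \<open>f ^ p\<close> and drops
    out; every other term has a factor \<open>x\<close> to spare.\<close>
  also have "\<dots> = (\<Sum>k\<le>q. of_nat (Suc q choose k) * (x * t k))"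
    using f by (simp add: q xt mult.assoc del: power_Suc)
  finally have fD: "f * (x + g * f) ^ Suc q = (\<Sum>k\<le>q. of_nat (Suc q choose k) * (x * t k))" .
  have "x * h + f * (x + g * f) ^ Suc q = (\<Sum>k\<le>q. of_nat (p choose Suc k) * (x * t k))"
    unfolding fD h_def sum_distrib_left sum.distrib [symmetric]
    by (rule sum.cong) (simp_all add: q algebra_simps)
  also have "\<dots> = 0"
  proof (rule sum.neutral, rule ballI)
    fix k assume "k \<in> {..q}"
    then have "p dvd (p choose Suc k)"
      by (intro dvd_choose_prime) (use p(1) q in auto)
    then have "of_nat (p choose Suc k) = (0 :: 'a)"
      using p(2) by (auto elim!: dvdE)
    then show "of_nat (p choose Suc k) * (x * t k) = 0" by simp
  qed
  finally show thesis
    using 1 by (intro that [of h]) (simp_all add: q)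
qed

section \<open>Exactness of a single operator relative to a submodule\<close>

locale module_char_p = Modules.module scale
  for scale :: "'a::comm_ring_1 \<Rightarrow> 'b::ab_group_add \<Rightarrow> 'b" (infixr \<open>*s\<close> 75) +
  fixes p :: nat
  assumes prime_p: "Factorial_Ring.prime p" and of_nat_p: "of_nat p = (0 :: 'a)"
begin

lemma p_gt_1: "p > 1"
  using prime_p prime_gt_1_nat by blast

definition exact_mod :: "'b set \<Rightarrow> 'a \<Rightarrow> bool" where
  "exact_mod J x \<longleftrightarrow> (\<forall>m. x ^ (p - 1) *s m \<in> J \<longrightarrow> (\<exists>q. m - x *s q \<in> J))"

text \<open>Exactness at one spot forces it at the other. If \<open>m\<close> is
  \<open>x ^ i *s q\<close> modulo \<open>J\<close>, multiplying by the missing power of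
  \<open>x\<close> sends \<open>m\<close> into \<open>J\<close>, as that power still has a factor
  \<open>x\<close>, and leaves \<open>x ^ (p - 1) *s q\<close>; so \<open>q\<close> is divisible by
  \<open>x\<close> and \<open>i\<close> can be raised.\<close>

lemma exact_mod_dual:
  assumes J: "subspace J" and ex: "exact_mod J x" and m: "x *s m \<in> J"
  obtains q where "m - x ^ (p - 1) *s q \<in> J"
proof -
  have "\<exists>q. m - x ^ i *s q \<in> J" if "i \<le> p - 1" for i
    using that
  proof (induction i)
    case 0
    show ?case
      using subspace_0 [OF J] by (intro exI [of _ m]) simp
  next
    case (Suc i)
    then obtain q where q: "m - x ^ i *s q \<in> J" by auto
    have "x ^ (p - 1 - i) = x ^ (p - 2 - i) * x"
      using Suc.prems p_gt_1 by (simp flip: power_Suc2 add: Suc_diff_Suc numeral_2_eq_2)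
    then have "x ^ (p - 1 - i) *s m \<in> J"
      using subspace_scale [OF J m, of "x ^ (p - 2 - i)"] by simp
    moreover have "x ^ (p - 1 - i) *s (m - x ^ i *s q) \<in> J"
      by (rule subspace_scale [OF J q])
    moreover have "x ^ (p - 1 - i) * x ^ i = x ^ (p - 1)"
      using Suc.prems by (simp flip: power_add)
    ultimately have "x ^ (p - 1) *s q \<in> J"
      using subspace_diff [OF J] by (fastforce simp: scale_right_diff_distrib)
    then obtain q' where q': "q - x *s q' \<in> J"
      using ex unfolding exact_mod_def by blast
    have "m - x ^ Suc i *s q' = (m - x ^ i *s q) + x ^ i *s (q - x *s q')"
      by (simp add: scale_right_diff_distrib mult.commute)
    then show ?case
      using subspace_add [OF J q subspace_scale [OF J q', of "x ^ i"]] by metis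
  qed
  then show thesis using that by blast
qed

text \<open>
  If \<open>D = x + g f\<close> and \<open>D ^ (p - 1)\<close> kills \<open>m\<close>, then \<open>m\<close> agrees modulo the image of \<open>D\<close> with
  \<open>g m'\<close> for some \<open>m'\<close> again killed by \<open>D ^ (p - 1)\<close>; as \<open>g\<close> is nilpotent, iterating this
  shows that \<open>m\<close> itself lies in the image of \<open>D\<close>.
\<close>
lemma exact_mod_perturb:
  assumes J: "subspace J" and ex: "exact_mod J x"
    and f: "f ^ p = 0" and g: "g ^ N = 0"
  shows "exact_mod J (x + g * f)"
proof -
  obtain h where h1: "(x + g * f) ^ (p - 1) = x ^ (p - 1) + g * h"
    and h2: "x * h + f * (x + g * f) ^ (p - 1) = 0"
    using perturbation_cofactor [OF prime_p of_nat_p f] by metis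
  define D where "D = x + g * f"
  have step: "\<exists>q m'. m - D *s q - g *s m' \<in> J \<and> D ^ (p - 1) *s m' \<in> J"
    if m: "D ^ (p - 1) *s m \<in> J" for m
  proof -
    \<comment> \<open>The cofactor identity converts the assumption on \<open>D\<close> into one on
      \<open>x\<close>, so the dual exactness applies to \<open>h *s m\<close>.\<close>
    have "x *s (h *s m) = - (f *s (D ^ (p - 1) *s m))"
      using h2 by (simp add: D_def eq_neg_iff_add_eq_0 flip: scale_left_distrib)
    then have "x *s (h *s m) \<in> J"
      using subspace_neg [OF J subspace_scale [OF J m, of f]] by simp
    then obtain l where l: "h *s m - x ^ (p - 1) *s l \<in> J"
      using exact_mod_dual [OF J ex] by blast
    have xD: "x ^ (p - 1) = D ^ (p - 1) - g * h"
      by (simp only: D_def h1 add_diff_cancel_right')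
    have "x ^ (p - 1) *s (m + g *s l) = x ^ (p - 1) *s m + g *s (x ^ (p - 1) *s l)"
      by (simp add: scale_right_distrib mult.commute)
    also have "x ^ (p - 1) *s m = D ^ (p - 1) *s m - g *s (h *s m)"
      unfolding xD by (simp add: scale_left_diff_distrib)
    finally have "x ^ (p - 1) *s (m + g *s l) = D ^ (p - 1) *s m - g *s (h *s m - x ^ (p - 1) *s l)"
      by (simp add: scale_right_diff_distrib)
    then have "x ^ (p - 1) *s (m + g *s l) \<in> J"
      using subspace_diff [OF J m subspace_scale [OF J l, of g]] by simp
    then obtain q where q: "m + g *s l - x *s q \<in> J"
      using ex unfolding exact_mod_def by blast
    \<comment> \<open>This choice is forced: replace \<open>x\<close> by \<open>D - g * f\<close> in
      the congruence of \<open>m + g *s l\<close> with \<open>x *s q\<close>.\<close>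
    define m' where "m' = - (f *s q + l)"
    have "m - D *s q - g *s m' = m + g *s l - x *s q"
      by (simp add: m'_def D_def scale_left_distrib scale_right_distrib scale_right_diff_distrib)
    then have 1: "m - D *s q - g *s m' \<in> J"
      using q by metis
    have fD: "f * D ^ (p - 1) = - (x * h)"
      using h2 by (simp add: D_def eq_neg_iff_add_eq_0 add.commute)
    have "D ^ (p - 1) *s m' = - ((f * D ^ (p - 1)) *s q) - D ^ (p - 1) *s l"
      by (simp add: m'_def scale_right_diff_distrib mult.commute)
    also have "\<dots> = (x * h) *s q - (x ^ (p - 1) + g * h) *s l"
      unfolding fD using h1 by (simp only: D_def scale_minus_left minus_minus)
    also have "\<dots> = (h *s m - x ^ (p - 1) *s l) - h *s (m + g *s l - x *s q)"
      by (simp add: scale_left_distrib scale_right_distrib scale_right_diff_distrib mult.commute)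
    also have "\<dots> \<in> J"
      by (rule subspace_diff [OF J l subspace_scale [OF J q]])
    finally show ?thesis using 1 by blast
  qed
  have "\<exists>q m'. m - D *s q - g ^ i *s m' \<in> J \<and> D ^ (p - 1) *s m' \<in> J"
    if m: "D ^ (p - 1) *s m \<in> J" for m i
  proof (induction i)
    case 0
    show ?case
      using m subspace_0 [OF J] by (intro exI [of _ 0] exI [of _ m]) simp
  next
    case (Suc i)
    then obtain q m1 where 1: "m - D *s q - g ^ i *s m1 \<in> J" "D ^ (p - 1) *s m1 \<in> J"
      by blast
    obtain q2 m2 where 2: "m1 - D *s q2 - g *s m2 \<in> J" "D ^ (p - 1) *s m2 \<in> J"
      using step [OF 1(2)] by blast
    have "m - D *s (q + g ^ i *s q2) - g ^ Suc i *s m2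
        = (m - D *s q - g ^ i *s m1) + g ^ i *s (m1 - D *s q2 - g *s m2)"
      by (simp add: scale_right_distrib scale_right_diff_distrib mult.commute)
    then have "m - D *s (q + g ^ i *s q2) - g ^ Suc i *s m2 \<in> J"
      using subspace_add [OF J 1(1) subspace_scale [OF J 2(1), of "g ^ i"]] by metis
    with 2(2) show ?case by blast
  qed
  from this [where i = N] show ?thesis
    unfolding exact_mod_def D_def [symmetric] using g by fastforce
qed

section \<open>The socle criterion and the exchange of basis vectors\<close>

definition rad_sub :: "('i \<Rightarrow> 'a) \<Rightarrow> 'i set \<Rightarrow> 'b set" where
  "rad_sub u I = range (\<lambda>m. \<Sum>i\<in>I. u i *s m i)"

text \<open>
  For pairwise commuting \<open>u i\<close> with \<open>u i ^ p = 0\<close> this says that the module is free over the truncated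
  polynomial algebra: the socle \<open>\<Prod>i\<in>I. u i ^ (p - 1)\<close> kills nothing outside the radical.
\<close>
definition socle_exact :: "('i \<Rightarrow> 'a) \<Rightarrow> 'i set \<Rightarrow> bool" where
  "socle_exact u I \<longleftrightarrow> (\<forall>m. (\<Prod>i\<in>I. u i ^ (p - 1)) *s m = 0 \<longrightarrow> m \<in> rad_sub u I)"

lemma subspace_rad_sub: "subspace (rad_sub u I)"
proof (rule subspaceI)
  show "0 \<in> rad_sub u I"
    unfolding rad_sub_def by (rule image_eqI [of _ _ "\<lambda>_. 0"]) simp_all
next
  fix x y assume "x \<in> rad_sub u I" "y \<in> rad_sub u I"
  then obtain m m' where "x = (\<Sum>i\<in>I. u i *s m i)" "y = (\<Sum>i\<in>I. u i *s m' i)"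
    unfolding rad_sub_def by auto
  then show "x + y \<in> rad_sub u I"
    unfolding rad_sub_def
    by (intro image_eqI [of _ _ "\<lambda>i. m i + m' i"]) (simp_all add: scale_right_distrib sum.distrib)
next
  fix c x assume "x \<in> rad_sub u I"
  then obtain m where "x = (\<Sum>i\<in>I. u i *s m i)"
    unfolding rad_sub_def by auto
  then show "c *s x \<in> rad_sub u I"
    unfolding rad_sub_def
    by (intro image_eqI [of _ _ "\<lambda>i. c *s m i"]) (simp_all add: scale_sum_right mult.commute)
qed

lemma rad_sub_cong: "(\<And>i. i \<in> I \<Longrightarrow> u i = w i) \<Longrightarrow> rad_sub u I = rad_sub w I"
  unfolding rad_sub_def by (intro image_cong sum.cong refl) auto

lemma socle_exact_cong: "(\<And>i. i \<in> I \<Longrightarrow> u i = w i) \<Longrightarrow> socle_exact u I = socle_exact w I"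
  unfolding socle_exact_def by (metis (no_types, lifting) prod.cong rad_sub_cong)

lemma rad_sub_insert:
  assumes "finite I" "j \<notin> I"
  shows "m \<in> rad_sub u (insert j I) \<longleftrightarrow> (\<exists>q. m - u j *s q \<in> rad_sub u I)"
proof
  assume "m \<in> rad_sub u (insert j I)"
  then obtain l where "m = (\<Sum>i\<in>insert j I. u i *s l i)"
    unfolding rad_sub_def by auto
  then have "m - u j *s l j = (\<Sum>i\<in>I. u i *s l i)"
    using assms by simp
  then show "\<exists>q. m - u j *s q \<in> rad_sub u I"
    unfolding rad_sub_def by blast
next
  assume "\<exists>q. m - u j *s q \<in> rad_sub u I"
  then obtain q l where "m - u j *s q = (\<Sum>i\<in>I. u i *s l i)"
    unfolding rad_sub_def by auto
  then have "m = u j *s q + (\<Sum>i\<in>I. u i *s l i)"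
    by (simp add: algebra_simps)
  also have "\<dots> = (\<Sum>i\<in>insert j I. u i *s (l(j := q)) i)"
    using assms by (simp, intro sum.cong refl) auto
  finally show "m \<in> rad_sub u (insert j I)"
    unfolding rad_sub_def by blast
qed

lemma socle_kills_rad_sub:
  assumes "finite I" "\<And>i. i \<in> I \<Longrightarrow> u i ^ p = 0" "m \<in> rad_sub u I"
  shows "(\<Prod>i\<in>I. u i ^ (p - 1)) *s m = 0"
proof -
  obtain l where l: "m = (\<Sum>i\<in>I. u i *s l i)"
    using assms(3) unfolding rad_sub_def by auto
  have "(\<Prod>i\<in>I. u i ^ (p - 1)) * u j = 0" if j: "j \<in> I" for j
  proof -
    have "(\<Prod>i\<in>I. u i ^ (p - 1)) * u j = (u j ^ (p - 1) * u j) * (\<Prod>i\<in>I - {j}. u i ^ (p - 1))"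
      using prod.remove [OF assms(1) j, of "\<lambda>i. u i ^ (p - 1)"] by (simp add: mult_ac)
    also have "u j ^ (p - 1) * u j = u j ^ p"
      using p_gt_1 by (simp flip: power_Suc2)
    finally show ?thesis
      using assms(2) [OF j] by simp
  qed
  then show ?thesis
    by (simp add: l scale_sum_right)
qed

text \<open>The criterion for all vectors is peeled into the criterion for all but one and exactness
  of the last modulo the images of the others. Since the partial socle kills those images,
  \<open>u j ^ (p - 1) *s m\<close> lying among them is already enough for the full socle to kill
  \<open>m\<close>.\<close>

lemma socle_exact_insert:
  assumes I: "finite I" "j \<notin> I" and u: "\<And>i. i \<in> insert j I \<Longrightarrow> u i ^ p = 0"
  shows "socle_exact u (insert j I) \<longleftrightarrow> socle_exact u I \<and> exact_mod (rad_sub u I) (u j)"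
proof -
  let ?s = "\<Prod>i\<in>I. u i ^ (p - 1)"
  have s: "(\<Prod>i\<in>insert j I. u i ^ (p - 1)) = ?s * u j ^ (p - 1)"
    using I by (simp add: mult.commute)
  note J = subspace_rad_sub [of u I]
  have kill: "?s *s m = 0" if "m \<in> rad_sub u I" for m
    using socle_kills_rad_sub [OF I(1) _ that] u by simp
  show ?thesis
  proof (intro iffI conjI)
    assume l: "socle_exact u (insert j I)"
    have l': "\<exists>q. m - u j *s q \<in> rad_sub u I" if "?s *s (u j ^ (p - 1) *s m) = 0" for m
      using l that unfolding socle_exact_def s rad_sub_insert [OF I] by simp
    show "exact_mod (rad_sub u I) (u j)"
      unfolding exact_mod_def using kill l' by blast
    show "socle_exact u I"
      unfolding socle_exact_def
    proof (intro allI impI)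
      fix m assume m: "?s *s m = 0"
      \<comment> \<open>Divisibility by \<open>u j\<close> is raised up to \<open>i = p\<close>,
        where the power vanishes and only the images of the other vectors remain.\<close>
      have "\<exists>q. m - u j ^ i *s q \<in> rad_sub u I" if "i \<le> p" for i
        using that
      proof (induction i)
        case 0
        show ?case using subspace_0 [OF J] by (intro exI [of _ m]) simp
      next
        case (Suc i)
        then obtain q where q: "m - u j ^ i *s q \<in> rad_sub u I" by auto
        have "?s *s (u j ^ i *s q) = 0"
          using kill [OF q] m by (simp add: scale_right_diff_distrib)
        then have "u j ^ (p - 1 - i) *s (?s *s (u j ^ i *s q)) = 0" by simp
        then have "?s *s ((u j ^ (p - 1 - i) * u j ^ i) *s q) = 0"
          by (simp add: mult_ac)
        then have "?s *s (u j ^ (p - 1) *s q) = 0"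
          using Suc.prems by (simp flip: power_add)
        then obtain q' where q': "q - u j *s q' \<in> rad_sub u I"
          using l' by blast
        have "m - u j ^ Suc i *s q' = (m - u j ^ i *s q) + u j ^ i *s (q - u j *s q')"
          by (simp add: scale_right_diff_distrib mult.commute)
        then show ?case
          using subspace_add [OF J q subspace_scale [OF J q', of "u j ^ i"]] by metis
      qed
      from this [of p] show "m \<in> rad_sub u I"
        using u [of j] by auto
    qed
  next
    assume r: "socle_exact u I \<and> exact_mod (rad_sub u I) (u j)"
    show "socle_exact u (insert j I)"
      using r unfolding socle_exact_def exact_mod_def s rad_sub_insert [OF I] by simp
  qed
qed

text \<open>The \<open>u i\<close> are exchanged for the \<open>w i\<close> one at a time.\<close>
lemma socle_exact_perturb:
  assumes fin: "finite I"
    and u: "\<And>i. i \<in> I \<Longrightarrow> u i ^ p = 0" and w: "\<And>i. i \<in> I \<Longrightarrow> w i ^ p = 0"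
    and exu: "\<And>i J. i \<in> I \<Longrightarrow> subspace J \<Longrightarrow> exact_mod J (u i) \<Longrightarrow> exact_mod J (w i)"
    and ex: "socle_exact u I"
  shows "socle_exact w I"
proof -
  have "socle_exact (\<lambda>i. if i \<in> K then w i else u i) I" if "K \<subseteq> I" for K
    using finite_subset [OF that fin] that
  proof (induction K rule: finite_induct)
    case empty
    then show ?case using ex by simp
  next
    case (insert j K)
    let ?a = "\<lambda>i. if i \<in> K then w i else u i" and ?b = "\<lambda>i. if i \<in> insert j K then w i else u i"
    define L where "L = I - {j}"
    have I: "I = insert j L" and L: "finite L" "j \<notin> L"
      using insert.prems fin by (auto simp: L_def)
    have "socle_exact ?a (insert j L)"
      using insert I by auto
    then have a: "socle_exact ?a L" "exact_mod (rad_sub ?a L) (u j)"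
      using socle_exact_insert [OF L, of ?a] u w I insert.hyps by auto
    have ab: "?a i = ?b i" if "i \<in> L" for i using that L by auto
    \<comment> \<open>Here the submodule is spanned by images of some old and some new operators,
      which is why \<open>exu\<close> must hold for every submodule.\<close>
    have "exact_mod (rad_sub ?b L) (w j)"
      using exu [OF _ subspace_rad_sub a(2)] insert.prems rad_sub_cong [of L ?a ?b, OF ab] by auto
    moreover have "socle_exact ?b L"
      using a(1) socle_exact_cong [of L ?a ?b, OF ab] by metis
    moreover have "?b i ^ p = 0" if "i \<in> insert j L" for i
      using u w I that by auto
    ultimately have "socle_exact ?b (insert j L)"
      using socle_exact_insert [OF L, of ?b] by simp
    then show ?case using I by metis
  qed
  from this [of I] have "socle_exact (\<lambda>i. if i \<in> I then w i else u i) I" by simp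
  then show ?thesis
    using socle_exact_cong [of I w "\<lambda>i. if i \<in> I then w i else u i"] by simp
qed

text \<open>A basis of the image subspace is indexed by its own vectors, whereas the exchange needs
  the old and the new family indexed by one set.\<close>

lemma socle_exact_reindex:
  fixes h :: "'i \<Rightarrow> 'j"
  assumes "inj_on h I"
  shows "socle_exact u (h ` I) \<longleftrightarrow> socle_exact (u \<circ> h) I"
proof -
  have "rad_sub u (h ` I) = rad_sub (u \<circ> h) I"
    unfolding rad_sub_def
  proof safe
    fix m :: "'j \<Rightarrow> 'b"
    have "(\<Sum>i\<in>h ` I. u i *s m i) = (\<Sum>i\<in>I. (u \<circ> h) i *s (m \<circ> h) i)"
      using assms by (simp add: sum.reindex)
    then show "(\<Sum>i\<in>h ` I. u i *s m i) \<in> range (\<lambda>m. \<Sum>i\<in>I. (u \<circ> h) i *s m i)"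
      by (rule range_eqI [where x = "m \<circ> h"])
  next
    fix m :: "'i \<Rightarrow> 'b"
    have "(\<Sum>i\<in>I. (u \<circ> h) i *s m i) = (\<Sum>i\<in>h ` I. u i *s m (the_inv_into I h i))"
      using assms by (simp add: sum.reindex the_inv_into_f_f cong: sum.cong)
    then show "(\<Sum>i\<in>I. (u \<circ> h) i *s m i) \<in> range (\<lambda>m. \<Sum>i\<in>h ` I. u i *s m i)"
      by (rule range_eqI [where x = "\<lambda>i. m (the_inv_into I h i)"])
  qed
  moreover have "(\<Prod>i\<in>h ` I. u i ^ (p - 1)) = (\<Prod>i\<in>I. (u \<circ> h) i ^ (p - 1))"
    using assms by (simp add: prod.reindex)
  ultimately show ?thesis
    unfolding socle_exact_def by simp
qed

end

section \<open>Evaluation of polynomials\<close>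

lemma poly_mapping_sum_single:
  fixes f :: "'a \<Rightarrow>\<^sub>0 'b::comm_monoid_add"
  shows "f = (\<Sum>m\<in>Poly_Mapping.keys f. Poly_Mapping.single m (Poly_Mapping.lookup f m))"
proof (rule poly_mapping_eqI)
  fix k
  show "Poly_Mapping.lookup f k = Poly_Mapping.lookup (\<Sum>m\<in>Poly_Mapping.keys f.
      Poly_Mapping.single m (Poly_Mapping.lookup f m)) k"
    by (cases "k \<in> Poly_Mapping.keys f")
      (auto simp: lookup_sum lookup_single when_def in_keys_iff sum.delta)
qed

lemma keys_diff_subset:
  fixes f g :: "'a \<Rightarrow>\<^sub>0 'b::ab_group_add"
  shows "Poly_Mapping.keys (f - g) \<subseteq> Poly_Mapping.keys f \<union> Poly_Mapping.keys g"
  by (auto simp: in_keys_iff lookup_minus)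

text \<open>Serves both the polynomial ring and the group algebra, making p-th powers additive in
  each.\<close>

lemma CHAR_poly_mapping:
  "CHAR('a::comm_monoid_add \<Rightarrow>\<^sub>0 'b::comm_ring_1) = CHAR('b)"
proof (rule CHAR_eqI)
  show "of_nat CHAR('b) = (0 :: 'a \<Rightarrow>\<^sub>0 'b)"
    by (simp flip: single_of_nat)
next
  fix n :: nat assume "of_nat n = (0 :: 'a \<Rightarrow>\<^sub>0 'b)"
  then have "Poly_Mapping.lookup (Poly_Mapping.single 0 (of_nat n) :: 'a \<Rightarrow>\<^sub>0 'b) 0 = 0"
    by simp
  then show "CHAR('b) dvd n"
    by (simp only: lookup_single_eq of_nat_eq_0_iff_char_dvd)
qed

definition monom_eval :: "('a \<Rightarrow> 'r) \<Rightarrow> ('a \<Rightarrow>\<^sub>0 nat) \<Rightarrow> 'r::comm_monoid_mult" where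
  "monom_eval \<phi> m = (\<Prod>u\<in>Poly_Mapping.keys m. \<phi> u ^ Poly_Mapping.lookup m u)"

text \<open>A common form for two substitutions: vectors themselves, with values in the group
  algebra, and linear forms in basis variables, with values in polynomials. In both targets the
  constants are the \<open>Poly_Mapping.single 0 c\<close>.\<close>

definition poly_eval ::
  "('a \<Rightarrow> 'd \<Rightarrow>\<^sub>0 'k) \<Rightarrow> ('a, 'k::field) mpoly \<Rightarrow> 'd::comm_monoid_add \<Rightarrow>\<^sub>0 'k" where
  "poly_eval \<phi> f = (\<Sum>m\<in>Poly_Mapping.keys f.
     Poly_Mapping.single 0 (Poly_Mapping.lookup f m) * monom_eval \<phi> m)"

lemma eval_poly_eq: "eval_poly = poly_eval (\<lambda>u. u)"
  by (simp add: fun_eq_iff eval_poly_def poly_eval_def monom_eval_def scalar_def)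

lemma monom_eval_superset:
  assumes "finite A" "Poly_Mapping.keys m \<subseteq> A"
  shows "monom_eval \<phi> m = (\<Prod>u\<in>A. \<phi> u ^ Poly_Mapping.lookup m u)"
  unfolding monom_eval_def
  by (rule prod.mono_neutral_left) (use assms in \<open>auto simp: in_keys_iff\<close>)

lemma monom_eval_0 [simp]: "monom_eval \<phi> 0 = 1"
  by (simp add: monom_eval_def)

lemma monom_eval_single [simp]: "monom_eval \<phi> (Poly_Mapping.single u n) = \<phi> u ^ n"
  by (simp add: monom_eval_def)

lemma monom_eval_add: "monom_eval \<phi> (m + m') = monom_eval \<phi> m * monom_eval \<phi> m'"
proof -
  let ?A = "Poly_Mapping.keys m \<union> Poly_Mapping.keys m'"
  have "monom_eval \<phi> (m + m') = (\<Prod>u\<in>?A. \<phi> u ^ Poly_Mapping.lookup (m + m') u)"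
    by (rule monom_eval_superset) (simp_all add: keys_add)
  also have "\<dots> = monom_eval \<phi> m * monom_eval \<phi> m'"
    by (simp add: lookup_add power_add prod.distrib monom_eval_superset [of ?A])
  finally show ?thesis .
qed

lemma poly_eval_superset:
  assumes "finite A" "Poly_Mapping.keys f \<subseteq> A"
  shows "poly_eval \<phi> f = (\<Sum>m\<in>A. Poly_Mapping.single 0 (Poly_Mapping.lookup f m) * monom_eval \<phi> m)"
  unfolding poly_eval_def
  by (rule sum.mono_neutral_left) (use assms in \<open>auto simp: in_keys_iff\<close>)

lemma poly_eval_0 [simp]: "poly_eval \<phi> 0 = 0"
  by (simp add: poly_eval_def)

lemma poly_eval_add: "poly_eval \<phi> (f + g) = poly_eval \<phi> f + poly_eval \<phi> g"
proof -
  let ?A = "Poly_Mapping.keys f \<union> Poly_Mapping.keys g"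
  have "poly_eval \<phi> (f + g) = (\<Sum>m\<in>?A.
      Poly_Mapping.single 0 (Poly_Mapping.lookup (f + g) m) * monom_eval \<phi> m)"
    by (rule poly_eval_superset) (simp_all add: keys_add)
  also have "\<dots> = poly_eval \<phi> f + poly_eval \<phi> g"
    by (simp add: lookup_add single_add distrib_right sum.distrib poly_eval_superset [of ?A])
  finally show ?thesis .
qed

lemma poly_eval_sum: "poly_eval \<phi> (\<Sum>i\<in>A. f i) = (\<Sum>i\<in>A. poly_eval \<phi> (f i))"
  by (induction A rule: infinite_finite_induct) (simp_all add: poly_eval_add)

lemma poly_eval_diff: "poly_eval \<phi> (f - g) = poly_eval \<phi> f - poly_eval \<phi> g"
  using poly_eval_add [of \<phi> "f - g" g] by simp

lemma poly_eval_single [simp]: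
  "poly_eval \<phi> (Poly_Mapping.single m c) = Poly_Mapping.single 0 c * monom_eval \<phi> m"
  by (simp add: poly_eval_def)

lemma poly_eval_mult: "poly_eval \<phi> (f * g) = poly_eval \<phi> f * poly_eval \<phi> g"
proof -
  let ?s = "\<lambda>f m. Poly_Mapping.single m (Poly_Mapping.lookup f m)"
  have "f * g = (\<Sum>m\<in>Poly_Mapping.keys f. ?s f m) * (\<Sum>m\<in>Poly_Mapping.keys g. ?s g m)"
    by (simp flip: poly_mapping_sum_single)
  also have "poly_eval \<phi> \<dots> = poly_eval \<phi> f * poly_eval \<phi> g"
    unfolding sum_product poly_eval_sum mult_single poly_eval_def [of \<phi> f] poly_eval_def [of \<phi> g]
    by (intro sum.cong refl) (simp add: monom_eval_add mult_ac flip: mult_single [of 0 _ 0, simplified])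
  finally show ?thesis .
qed

lemma poly_eval_1 [simp]: "poly_eval \<phi> 1 = 1"
  using poly_eval_single [of \<phi> 0 1] by simp

lemma poly_eval_power: "poly_eval \<phi> (f ^ n) = poly_eval \<phi> f ^ n"
  by (induction n) (simp_all add: poly_eval_mult)

lemma poly_eval_Var [simp]: "poly_eval \<phi> (Var u) = \<phi> u"
  by (simp add: Var_def)

lemma poly_eval_Const [simp]: "poly_eval \<phi> (Const c) = Poly_Mapping.single 0 c"
  by (simp add: Const_def)

lemma Var_power: "Var u ^ n = (Poly_Mapping.single (Poly_Mapping.single u n) 1 :: ('a, 'c::field) mpoly)"
  by (induction n) (simp_all add: Var_def mult_single single_add [symmetric])

text \<open>Lets a monomial be compared factor by factor with its image under a
  substitution.\<close>

lemma single_eq_monom_eval_Var: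
  "Poly_Mapping.single m c = Const c * monom_eval (Var :: 'a \<Rightarrow> ('a, 'k::field) mpoly) m"
proof -
  have "(\<Prod>u\<in>A. Var u ^ Poly_Mapping.lookup m u) =
      (Poly_Mapping.single (\<Sum>u\<in>A. Poly_Mapping.single u (Poly_Mapping.lookup m u)) 1 :: ('a, 'k) mpoly)" for A
    by (induction A rule: infinite_finite_induct) (simp_all add: Var_power mult_single)
  then have "monom_eval (Var :: 'a \<Rightarrow> ('a, 'k) mpoly) m = Poly_Mapping.single m 1"
    by (simp add: monom_eval_def flip: poly_mapping_sum_single)
  then show ?thesis
    by (simp add: Const_def mult_single)
qed

section \<open>The truncated symmetric algebra\<close>

lemma poly_ring_simps [simp]:
  "monoid.mult (poly_ring U) = (*)" "monoid.one (poly_ring U) = 1"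
  "ring.zero (poly_ring U) = 0" "ring.add (poly_ring U) = (+)"
  by (simp_all add: poly_ring_def)

lemma poly_ring_carrier_iff:
  "f \<in> carrier (poly_ring U) \<longleftrightarrow> (\<forall>m\<in>Poly_Mapping.keys f. Poly_Mapping.keys m \<subseteq> U)"
  by (simp add: poly_ring_def)

lemma Const_in_poly_ring [simp]: "Const c \<in> carrier (poly_ring U)"
  by (simp add: poly_ring_carrier_iff Const_def)

lemma Var_in_poly_ring [simp]: "Var u \<in> carrier (poly_ring U) \<longleftrightarrow> u \<in> U"
  by (simp add: poly_ring_carrier_iff Var_def)

lemma poly_ring_closed [simp]:
  fixes f g :: "('a, 'k::field) mpoly"
  shows "0 \<in> carrier (poly_ring U)" "1 \<in> carrier (poly_ring U)"
    and "f \<in> carrier (poly_ring U) \<Longrightarrow> g \<in> carrier (poly_ring U) \<Longrightarrow> f + g \<in> carrier (poly_ring U)"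
    and "f \<in> carrier (poly_ring U) \<Longrightarrow> g \<in> carrier (poly_ring U) \<Longrightarrow> f - g \<in> carrier (poly_ring U)"
    and "f \<in> carrier (poly_ring U) \<Longrightarrow> - f \<in> carrier (poly_ring U)"
    and "f \<in> carrier (poly_ring U) \<Longrightarrow> g \<in> carrier (poly_ring U) \<Longrightarrow> f * g \<in> carrier (poly_ring U)"
proof -
  show "- f \<in> carrier (poly_ring U)" if "f \<in> carrier (poly_ring U)"
    using that by (simp add: poly_ring_carrier_iff in_keys_iff)
  show "f + g \<in> carrier (poly_ring U)" "f - g \<in> carrier (poly_ring U)"
    if "f \<in> carrier (poly_ring U)" "g \<in> carrier (poly_ring U)"
    using that keys_add [of f g] keys_diff_subset [of f g] unfolding poly_ring_carrier_iff by blast+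
  show "f * g \<in> carrier (poly_ring U)"
    if "f \<in> carrier (poly_ring U)" "g \<in> carrier (poly_ring U)"
    unfolding poly_ring_carrier_iff
  proof (rule ballI, rule subsetI)
    fix m x assume m: "m \<in> Poly_Mapping.keys (f * g)" and x: "x \<in> Poly_Mapping.keys m"
    obtain a b where "a \<in> Poly_Mapping.keys f" "b \<in> Poly_Mapping.keys g" "m = a + b"
      using keys_mult [of f g] m by auto
    then show "x \<in> U"
      using that x keys_add [of a b] unfolding poly_ring_carrier_iff by blast
  qed
qed (simp_all add: poly_ring_carrier_iff)

lemma poly_ring_sum:
  "(\<And>i. i \<in> A \<Longrightarrow> f i \<in> carrier (poly_ring U)) \<Longrightarrow> sum f A \<in> carrier (poly_ring U)"
  by (induction A rule: infinite_finite_induct) simp_all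

lemma poly_ring_prod:
  "(\<And>i. i \<in> A \<Longrightarrow> f i \<in> carrier (poly_ring U)) \<Longrightarrow> prod f A \<in> carrier (poly_ring U)"
  by (induction A rule: infinite_finite_induct) simp_all

lemma poly_ring_power:
  "f \<in> carrier (poly_ring U) \<Longrightarrow> f ^ n \<in> carrier (poly_ring U)"
  by (induction n) simp_all

lemma cring_poly_ring: "cring (poly_ring U)"
proof (rule cringI)
  show "abelian_group (poly_ring U)"
  proof (rule abelian_groupI)
    fix f assume "f \<in> carrier (poly_ring U)"
    then show "\<exists>g\<in>carrier (poly_ring U). g \<oplus>\<^bsub>poly_ring U\<^esub> f = \<zero>\<^bsub>poly_ring U\<^esub>"
      by (intro bexI [of _ "- f"]) simp_all
  qed (simp_all add: add_ac)
  show "Group.comm_monoid (poly_ring U)"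
    by (rule comm_monoidI) (simp_all add: mult_ac)
qed (simp_all add: distrib_right)

lemma carrier_FactRing: "carrier (R Quot I) = (\<lambda>x. I +>\<^bsub>R\<^esub> x) ` carrier R"
  unfolding FactRing_def A_RCOSETS_defs a_r_coset_def by auto

definition sym_rels ::
  "('e::ab_group_add, 'k::field) group_algebra set \<Rightarrow> (('e, 'k) group_algebra, 'k) mpoly set" where
  "sym_rels U = {Var (u + v) - (Var u + Var v) | u v. u \<in> U \<and> v \<in> U} \<union>
     {Var (gscale c u) - Const c * Var u | c u. u \<in> U}"

definition C_proj ::
  "nat \<Rightarrow> ('e::ab_group_add, 'k::field) group_algebra set
     \<Rightarrow> (('e, 'k) group_algebra, 'k) mpoly \<Rightarrow> (('e, 'k) group_algebra, 'k) mpoly set set" where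
  "C_proj p U f = genideal (sym_algebra U) ((\<lambda>u. sym_incl U u [^]\<^bsub>sym_algebra U\<^esub> p) ` U)
     +>\<^bsub>sym_algebra U\<^esub> (sym_ideal U +>\<^bsub>poly_ring U\<^esub> f)"

text \<open>Equality in \<open>C p U\<close> becomes membership of a difference in this ideal, so
  later arguments avoid cosets of cosets.\<close>

definition C_ker ::
  "nat \<Rightarrow> ('e::ab_group_add, 'k::field) group_algebra set \<Rightarrow> (('e, 'k) group_algebra, 'k) mpoly set" where
  "C_ker p U = {f \<in> carrier (poly_ring U). C_proj p U f = \<zero>\<^bsub>C p U\<^esub>}"

locale truncated_sym =
  fixes U :: "('e::ab_group_add, 'k::field) group_algebra set" and p :: nat
  assumes subspace_U: "module.subspace gscale U"
begin

sublocale gs: vector_space gscale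
  by (rule vector_space_gscale)

lemma U_closed: "0 \<in> U" "u \<in> U \<Longrightarrow> v \<in> U \<Longrightarrow> u + v \<in> U" "u \<in> U \<Longrightarrow> gscale c u \<in> U"
  using subspace_U by (auto simp: gs.subspace_def)

lemma U_sum: "(\<And>i. i \<in> A \<Longrightarrow> f i \<in> U) \<Longrightarrow> sum f A \<in> U"
  by (rule gs.subspace_sum [OF subspace_U])

lemma sym_rels_carrier: "sym_rels U \<subseteq> carrier (poly_ring U)"
  by (auto simp: sym_rels_def U_closed)

interpretation P: cring "poly_ring U"
  by (rule cring_poly_ring)

lemma sym_ideal_eq: "sym_ideal U = genideal (poly_ring U) (sym_rels U)"
  by (simp add: sym_ideal_def sym_rels_def)

interpretation I: ideal "sym_ideal U" "poly_ring U"
  unfolding sym_ideal_eq by (rule P.genideal_ideal [OF sym_rels_carrier])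

interpretation S: cring "sym_algebra U"
  unfolding sym_algebra_def by (rule I.quotient_is_cring [OF cring_poly_ring])

lemma hom1: "(\<lambda>f. sym_ideal U +>\<^bsub>poly_ring U\<^esub> f) \<in> Ring.ring_hom (poly_ring U) (sym_algebra U)"
  unfolding sym_algebra_def by (rule I.rcos_ring_hom)

lemma sym_incl_carrier: "u \<in> U \<Longrightarrow> sym_incl U u \<in> carrier (sym_algebra U)"
  unfolding sym_incl_def by (rule ring_hom_closed [OF hom1]) simp

lemma sym_incl_power:
  assumes "u \<in> U"
  shows "sym_incl U u [^]\<^bsub>sym_algebra U\<^esub> n = sym_ideal U +>\<^bsub>poly_ring U\<^esub> (Var u ^ n)"
proof (induction n)
  case 0
  show ?case using ring_hom_one [OF hom1] by simp
next
  case (Suc n)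
  then show ?case
    using ring_hom_mult [OF hom1, of "Var u ^ n" "Var u"] assms
    by (simp add: sym_incl_def poly_ring_power mult.commute)
qed

interpretation J: ideal "genideal (sym_algebra U) ((\<lambda>u. sym_incl U u [^]\<^bsub>sym_algebra U\<^esub> p) ` U)"
  "sym_algebra U"
  by (rule S.genideal_ideal) (auto intro!: S.nat_pow_closed sym_incl_carrier)

lemma cring_C: "cring (C p U)"
  unfolding C_def by (rule J.quotient_is_cring [OF S.is_cring])

interpretation A: cring "C p U"
  by (rule cring_C)

lemma C_proj_hom: "C_proj p U \<in> Ring.ring_hom (poly_ring U) (C p U)"
  using ring_hom_trans [OF hom1 J.rcos_ring_hom]
  by (simp add: C_proj_def [abs_def] C_def o_def)

lemma C_proj_carrier [simp]:
  "f \<in> carrier (poly_ring U) \<Longrightarrow> C_proj p U f \<in> carrier (C p U)"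
  by (rule ring_hom_closed [OF C_proj_hom])

lemma C_proj_add:
  "f \<in> carrier (poly_ring U) \<Longrightarrow> g \<in> carrier (poly_ring U)
    \<Longrightarrow> C_proj p U (f + g) = C_proj p U f \<oplus>\<^bsub>C p U\<^esub> C_proj p U g"
  using ring_hom_add [OF C_proj_hom] by simp

lemma C_proj_mult:
  "f \<in> carrier (poly_ring U) \<Longrightarrow> g \<in> carrier (poly_ring U)
    \<Longrightarrow> C_proj p U (f * g) = C_proj p U f \<otimes>\<^bsub>C p U\<^esub> C_proj p U g"
  using ring_hom_mult [OF C_proj_hom] by simp

lemma sym_algebra_carrier:
  "carrier (sym_algebra U) = (\<lambda>f. sym_ideal U +>\<^bsub>poly_ring U\<^esub> f) ` carrier (poly_ring U)"
  by (simp add: sym_algebra_def carrier_FactRing)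

lemma C_carrier: "carrier (C p U) = C_proj p U ` carrier (poly_ring U)"
  by (simp add: C_def carrier_FactRing sym_algebra_carrier C_proj_def [abs_def] image_image)

lemma C_proj_eq_iff:
  assumes "f \<in> carrier (poly_ring U)" "g \<in> carrier (poly_ring U)"
  shows "C_proj p U f = C_proj p U g \<longleftrightarrow> f - g \<in> C_ker p U"
proof -
  have "C_proj p U f = C_proj p U (f - g) \<oplus>\<^bsub>C p U\<^esub> C_proj p U g"
    using C_proj_add [of "f - g" g] assms by simp
  then show ?thesis
    using assms by (auto simp: C_ker_def)
qed

lemma C_proj_0: "C_proj p U 0 = \<zero>\<^bsub>C p U\<^esub>"
  using ring_hom_zero [OF C_proj_hom P.ring_axioms A.ring_axioms] by simp

lemma C_ker_0: "0 \<in> C_ker p U"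
  by (simp add: C_ker_def C_proj_0)

lemma C_ker_add: "f \<in> C_ker p U \<Longrightarrow> g \<in> C_ker p U \<Longrightarrow> f + g \<in> C_ker p U"
  by (simp add: C_ker_def C_proj_add)

lemma C_ker_mult: "f \<in> C_ker p U \<Longrightarrow> g \<in> carrier (poly_ring U) \<Longrightarrow> g * f \<in> C_ker p U"
  by (simp add: C_ker_def C_proj_mult)

lemma C_ker_sum: "(\<And>i. i \<in> A \<Longrightarrow> f i \<in> C_ker p U) \<Longrightarrow> sum f A \<in> C_ker p U"
  by (induction A rule: infinite_finite_induct) (simp_all add: C_ker_0 C_ker_add)

lemma C_ker_minus: "f \<in> C_ker p U \<Longrightarrow> - f \<in> C_ker p U"
  using C_ker_mult [of f "- 1"] by simp

text \<open>\<open>alpha\<close> evaluates all members of \<open>\<Union> z\<close>; this identifies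
  them as one full fibre of the projection from polynomials, hence as one class modulo
  \<open>C_ker\<close>.\<close>

lemma Union_C_proj:
  assumes f: "f \<in> carrier (poly_ring U)"
  shows "\<Union> (C_proj p U f) = {g \<in> carrier (poly_ring U). C_proj p U g = C_proj p U f}"
proof (intro equalityI subsetI)
  let ?c = "\<lambda>f. sym_ideal U +>\<^bsub>poly_ring U\<^esub> f"
  have cf: "?c f \<in> carrier (sym_algebra U)"
    using f by (simp add: sym_algebra_carrier)
  {
    fix g assume "g \<in> \<Union> (C_proj p U f)"
    then obtain Z where Z: "Z \<in> C_proj p U f" "g \<in> Z" by auto
    have "Z \<in> carrier (sym_algebra U)"
      using Z(1) J.a_rcosets_carrier [OF S.a_rcosetsI [OF J.a_subset cf]]
      by (auto simp: C_proj_def)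
    then obtain h where h: "h \<in> carrier (poly_ring U)" "Z = ?c h"
      by (auto simp: sym_algebra_carrier)
    have g: "g \<in> carrier (poly_ring U)"
      using Z(2) h I.a_rcosets_carrier [OF P.a_rcosetsI [OF I.a_subset h(1)]] by auto
    have "?c g = Z"
      using I.a_repr_independence' [of g h] Z h by simp
    moreover have "C_proj p U f = C_proj p U h"
      using J.a_repr_independence' [of "?c h" "?c f"] Z(1) h cf by (simp add: C_proj_def)
    ultimately show "g \<in> {g \<in> carrier (poly_ring U). C_proj p U g = C_proj p U f}"
      using g h by (simp add: C_proj_def)
  next
    fix g assume "g \<in> {g \<in> carrier (poly_ring U). C_proj p U g = C_proj p U f}"
    then have g: "g \<in> carrier (poly_ring U)" "C_proj p U g = C_proj p U f" by auto
    have "?c g \<in> C_proj p U g"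
      unfolding C_proj_def using g by (intro J.a_rcos_self) (simp add: sym_algebra_carrier)
    moreover have "g \<in> ?c g"
      using g by (intro I.a_rcos_self)
    ultimately show "g \<in> \<Union> (C_proj p U f)"
      using g by auto
  }
qed

lemma sym_rels_subset_C_ker: "sym_rels U \<subseteq> C_ker p U"
proof
  fix f assume f: "f \<in> sym_rels U"
  then have fc: "f \<in> carrier (poly_ring U)" using sym_rels_carrier by auto
  have "f \<in> sym_ideal U"
    using P.genideal_self [OF sym_rels_carrier] f unfolding sym_ideal_eq by auto
  then have "sym_ideal U +>\<^bsub>poly_ring U\<^esub> f = sym_ideal U"
    by (rule I.a_rcos_const)
  also have "\<dots> = sym_ideal U +>\<^bsub>poly_ring U\<^esub> 0"
    by (rule I.a_rcos_const [symmetric]) (use I.zero_closed in simp)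
  finally show "f \<in> C_ker p U"
    using C_proj_0 fc by (simp add: C_ker_def C_proj_def)
qed

lemma Var_power_in_C_ker:
  assumes u: "u \<in> U"
  shows "Var u ^ p \<in> C_ker p U"
proof -
  let ?J = "genideal (sym_algebra U) ((\<lambda>u. sym_incl U u [^]\<^bsub>sym_algebra U\<^esub> p) ` U)"
  have "sym_incl U u [^]\<^bsub>sym_algebra U\<^esub> p \<in> ?J"
    using S.genideal_self [of "(\<lambda>u. sym_incl U u [^]\<^bsub>sym_algebra U\<^esub> p) ` U"] u
    by (auto intro!: S.nat_pow_closed sym_incl_carrier)
  then have "C_proj p U (Var u ^ p) = ?J"
    unfolding C_proj_def using sym_incl_power [OF u] J.a_rcos_const by simp
  then show ?thesis
    using u by (simp add: C_ker_def C_def FactRing_def poly_ring_power)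
qed

text \<open>Any ideal \<open>K\<close> with both kinds of relation contains
  \<open>sym_ideal U\<close>, and its image in the symmetric algebra is an ideal containing the p-th
  powers. An element of the kernel thus differs from one of \<open>K\<close> by an element of
  \<open>sym_ideal U\<close>. This replaces the universal property of \<open>C p U\<close>:
  statements about the kernel follow by exhibiting a suitable \<open>K\<close>.\<close>

lemma C_ker_minimal:
  assumes K: "K \<subseteq> carrier (poly_ring U)" "0 \<in> K" "\<And>f g. f \<in> K \<Longrightarrow> g \<in> K \<Longrightarrow> f + g \<in> K"
    "\<And>f g. f \<in> K \<Longrightarrow> g \<in> carrier (poly_ring U) \<Longrightarrow> g * f \<in> K"
    and rels: "sym_rels U \<subseteq> K" "\<And>u. u \<in> U \<Longrightarrow> Var u ^ p \<in> K"
  shows "C_ker p U \<subseteq> K"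
proof
  let ?c = "\<lambda>f. sym_ideal U +>\<^bsub>poly_ring U\<^esub> f"
  let ?J = "genideal (sym_algebra U) ((\<lambda>u. sym_incl U u [^]\<^bsub>sym_algebra U\<^esub> p) ` U)"
  have minus: "- f \<in> K" if "f \<in> K" for f
    using K(4) [OF that, of "- 1"] by simp
  have inv: "inv\<^bsub>add_monoid (poly_ring U)\<^esub> f = - f" if "f \<in> carrier (poly_ring U)" for f
    using P.minus_equality [of "- f" f] that by (simp add: a_inv_def)
  have idK: "ideal K (poly_ring U)"
  proof (rule idealI)
    show "subgroup K (add_monoid (poly_ring U))"
    proof
      fix f assume f: "f \<in> K"
      then have "f \<in> carrier (poly_ring U)" using K(1) by blast
      from inv [OF this] show "inv\<^bsub>add_monoid (poly_ring U)\<^esub> f \<in> K"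
        using minus [OF f] by (simp only:)
    qed (use K in auto)
  qed (use K P.ring_axioms in \<open>auto simp: mult.commute\<close>)
  have IK: "sym_ideal U \<subseteq> K"
    unfolding sym_ideal_eq by (rule P.genideal_minimal [OF idK rels(1)])
  have "ideal (?c ` K) (sym_algebra U)"
    unfolding sym_algebra_def by (rule P.ring_ideal_imp_quot_ideal [OF I.ideal_axioms idK])
  moreover have "(\<lambda>u. sym_incl U u [^]\<^bsub>sym_algebra U\<^esub> p) ` U \<subseteq> ?c ` K"
    using rels(2) by (auto simp: sym_incl_power)
  ultimately have JK: "?J \<subseteq> ?c ` K"
    by (rule S.genideal_minimal)
  fix f assume "f \<in> C_ker p U"
  then have f: "f \<in> carrier (poly_ring U)" and "C_proj p U f = ?J"
    by (auto simp: C_ker_def C_def FactRing_def)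
  then have "?c f \<in> ?J"
    unfolding C_proj_def by (intro J.rcos_const_imp_mem) (auto simp: sym_algebra_carrier)
  then obtain k where k: "k \<in> K" "?c f = ?c k"
    using JK by auto
  then have "f \<in> ?c k"
    using I.a_rcos_self [OF f] by simp
  then obtain i where "i \<in> sym_ideal U" "f = i + k"
    by (auto simp: a_r_coset_def')
  then show "f \<in> K"
    using IK K(3) k(1) by auto
qed

end

section \<open>Representatives in basis variables and the socle monomial\<close>

locale truncated_sym_basis = truncated_sym U p
  for U :: "('e::ab_group_add, 'k::field) group_algebra set" and p +
  fixes B :: "('e, 'k) group_algebra set"
  assumes finite_B: "finite B" and independent_B: "\<not> module.dependent gscale B"
    and span_B: "module.span gscale B = U"
    and char_k: "CHAR('k) = p" and prime_char: "Factorial_Ring.prime p"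
    and nilpotent_U: "u \<in> U \<Longrightarrow> u ^ p = 0"
begin

abbreviation coord where "coord \<equiv> gs.representation B"

text \<open>The expansion of a vector in the basis, read as a linear form in the basis
  variables.\<close>

definition lin :: "('e, 'k) group_algebra \<Rightarrow> (('e, 'k) group_algebra, 'k) mpoly" where
  "lin u = (\<Sum>b\<in>B. Const (coord u b) * Var b)"

definition trunc_monoms :: "(('e, 'k) group_algebra \<Rightarrow>\<^sub>0 nat) set" where
  "trunc_monoms = {m. Poly_Mapping.keys m \<subseteq> B \<and> (\<forall>b. Poly_Mapping.lookup m b < p)}"

definition socle :: "(('e, 'k) group_algebra, 'k) mpoly" where
  "socle = (\<Prod>b\<in>B. Var b ^ (p - 1))"

lemma p_gt_0: "p > 0"
  using prime_char by (rule prime_gt_0_nat)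

lemma B_subset_U: "B \<subseteq> U"
  using gs.span_superset [of B] span_B by auto

lemma socle_closed: "socle \<in> carrier (poly_ring U)"
  unfolding socle_def using B_subset_U by (intro poly_ring_prod poly_ring_power) auto

lemma Const_add: "Const (a + b) = Const a + Const b"
  by (simp add: Const_def single_add)

lemma Const_mult: "Const (a * b) = Const a * Const b"
  by (simp add: Const_def mult_single)

lemma Const_0: "Const 0 = 0" and Const_1: "Const 1 = 1"
  by (simp_all add: Const_def)

lemma lin_add: "u \<in> U \<Longrightarrow> v \<in> U \<Longrightarrow> lin (u + v) = lin u + lin v"
  using independent_B
  by (simp add: lin_def gs.representation_add span_B Const_add distrib_right sum.distrib)

lemma lin_scale: "u \<in> U \<Longrightarrow> lin (gscale c u) = Const c * lin u"
  using independent_B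
  by (simp add: lin_def gs.representation_scale span_B Const_mult mult_ac sum_distrib_left)

lemma lin_closed: "lin u \<in> carrier (poly_ring B)"
  unfolding lin_def by (intro poly_ring_sum) simp

lemma lin_basis: "b \<in> B \<Longrightarrow> lin b = Var b"
  using independent_B finite_B
  by (simp add: lin_def gs.representation_basis if_distrib Const_0 Const_1 if_distribR sum.delta
      cong: if_cong)

lemma poly_ring_mono: "A \<subseteq> A' \<Longrightarrow> carrier (poly_ring A) \<subseteq> carrier (poly_ring A')"
  by (force simp: poly_ring_carrier_iff)

lemma lin_closed_U: "lin u \<in> carrier (poly_ring U)"
  using lin_closed poly_ring_mono [OF B_subset_U] by blast

lemma C_ker_Var_add:
  assumes "u \<in> U" "v \<in> U"
  shows "Var (u + v) - (Var u + Var v) \<in> C_ker p U"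
proof -
  have "Var (u + v) - (Var u + Var v) \<in> sym_rels U"
    unfolding sym_rels_def by (rule UnI1) (use assms in blast)
  then show ?thesis using sym_rels_subset_C_ker by (rule rev_subsetD)
qed

lemma C_ker_Var_scale:
  assumes "u \<in> U"
  shows "Var (gscale c u) - Const c * Var u \<in> C_ker p U"
proof -
  have "Var (gscale c u) - Const c * Var u \<in> sym_rels U"
    unfolding sym_rels_def by (rule UnI2) (use assms in blast)
  then show ?thesis using sym_rels_subset_C_ker by (rule rev_subsetD)
qed

lemma Var_minus_lin_in_C_ker:
  assumes u: "u \<in> U"
  shows "Var u - lin u \<in> C_ker p U"
proof -
  \<comment> \<open>\<open>Var 0\<close> is the variable named by the zero vector, not the zero
    polynomial; homogeneity with coefficient 0 puts it into the kernel.\<close>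
  have 0: "Var 0 \<in> C_ker p U"
    using C_ker_Var_scale [OF U_closed(1), of 0] by (simp add: Const_0)
  have "Var (\<Sum>b\<in>F. gscale (c b) b) - (\<Sum>b\<in>F. Const (c b) * Var b) \<in> C_ker p U"
    if "finite F" "F \<subseteq> B" for F c
    using that
  proof (induction F rule: finite_induct)
    case empty
    then show ?case using 0 by simp
  next
    case (insert b F)
    let ?s = "\<Sum>b\<in>F. gscale (c b) b"
    have s: "?s \<in> U"
      using insert.prems B_subset_U by (intro U_sum U_closed) auto
    have b: "b \<in> U"
      using insert.prems B_subset_U by auto
    have 1: "Var (gscale (c b) b + ?s) - (Var (gscale (c b) b) + Var ?s) \<in> C_ker p U"
      using C_ker_Var_add [OF U_closed(3) [OF b] s] .
    have 2: "Var (gscale (c b) b) - Const (c b) * Var b \<in> C_ker p U"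
      using C_ker_Var_scale [OF b] .
    have 3: "Var ?s - (\<Sum>b\<in>F. Const (c b) * Var b) \<in> C_ker p U"
      using insert by auto
    show ?case
      using C_ker_add [OF C_ker_add [OF 1 2] 3] insert.hyps by (simp add: algebra_simps)
  qed
  from this [OF finite_B order_refl, of "coord u"] show ?thesis
    using gs.sum_representation_eq [OF independent_B _ finite_B order_refl, of u] u
    by (simp add: span_B lin_def)
qed

lemma C_ker_prod_cong:
  assumes "\<And>i. i \<in> A \<Longrightarrow> f i \<in> carrier (poly_ring U)" "\<And>i. i \<in> A \<Longrightarrow> g i \<in> carrier (poly_ring U)"
    "\<And>i. i \<in> A \<Longrightarrow> f i - g i \<in> C_ker p U"
  shows "prod f A - prod g A \<in> C_ker p U"
  using assms
proof (induction A rule: infinite_finite_induct)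
  case (insert a A)
  have 1: "g a * (prod f A - prod g A) \<in> C_ker p U"
    using insert by (intro C_ker_mult) auto
  have 2: "prod f A * (f a - g a) \<in> C_ker p U"
    using insert by (intro C_ker_mult poly_ring_prod) auto
  show ?case
    using C_ker_add [OF 1 2] insert.hyps by (simp add: algebra_simps)
qed (simp_all add: C_ker_0)

lemma poly_eval_lin_closed: "poly_eval lin f \<in> carrier (poly_ring B)"
  unfolding poly_eval_def monom_eval_def Const_def [symmetric]
  by (intro poly_ring_sum poly_ring_closed Const_in_poly_ring poly_ring_prod poly_ring_power lin_closed)

lemma minus_poly_eval_lin_in_C_ker:
  assumes f: "f \<in> carrier (poly_ring U)"
  shows "f - poly_eval lin f \<in> C_ker p U"
proof -
  have "f - poly_eval lin f = (\<Sum>m\<in>Poly_Mapping.keys f.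
      Poly_Mapping.single m (Poly_Mapping.lookup f m) - Const (Poly_Mapping.lookup f m) * monom_eval lin m)"
    unfolding sum_subtractf by (simp add: poly_eval_def Const_def flip: poly_mapping_sum_single)
  also have "\<dots> = (\<Sum>m\<in>Poly_Mapping.keys f.
      Const (Poly_Mapping.lookup f m) * (monom_eval Var m - monom_eval lin m))"
    by (simp add: single_eq_monom_eval_Var right_diff_distrib)
  also have "\<dots> \<in> C_ker p U"
  proof (intro C_ker_sum C_ker_mult)
    fix m assume m: "m \<in> Poly_Mapping.keys f"
    \<comment> \<open>Powers are treated as products of \<open>n\<close> equal factors, so the
      congruence for products applies.\<close>
    have "Var u ^ n - lin u ^ n \<in> C_ker p U" if "u \<in> Poly_Mapping.keys m" for u n
    proof -
      have "u \<in> U" using f m that by (auto simp: poly_ring_carrier_iff)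
      then show ?thesis
        using C_ker_prod_cong [of "{..<n}" "\<lambda>_. Var u" "\<lambda>_. lin u"] Var_minus_lin_in_C_ker lin_closed_U
        by simp
    qed
    moreover have "Poly_Mapping.keys m \<subseteq> U" using f m by (simp add: poly_ring_carrier_iff)
    ultimately show "monom_eval Var m - monom_eval lin m \<in> C_ker p U"
      unfolding monom_eval_def by (intro C_ker_prod_cong poly_ring_power lin_closed_U) auto
  qed simp
  finally show ?thesis .
qed

text \<open>
  Substituting \<open>lin u\<close> for \<open>Var u\<close> eliminates the linear relations and carries \<open>C_ker\<close> into the
  monomial ideal generated by the \<open>p\<close>-th powers of the variables, which does not contain \<open>socle\<close>.
\<close>
definition monom_ideal :: "(('e, 'k) group_algebra, 'k) mpoly set" where
  "monom_ideal = {q. \<forall>m\<in>Poly_Mapping.keys q. \<exists>b. p \<le> Poly_Mapping.lookup m b}"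

lemma monom_ideal_closed:
  shows "0 \<in> monom_ideal"
    and "f \<in> monom_ideal \<Longrightarrow> g \<in> monom_ideal \<Longrightarrow> f + g \<in> monom_ideal"
    and "f \<in> monom_ideal \<Longrightarrow> g * f \<in> monom_ideal"
proof -
  show "f + g \<in> monom_ideal" if "f \<in> monom_ideal" "g \<in> monom_ideal"
    using that keys_add [of f g] unfolding monom_ideal_def by blast
  show "g * f \<in> monom_ideal" if f: "f \<in> monom_ideal"
    unfolding monom_ideal_def
  proof (rule CollectI, rule ballI)
    fix m assume "m \<in> Poly_Mapping.keys (g * f)"
    then obtain a b where "b \<in> Poly_Mapping.keys f" and m: "m = a + b"
      using keys_mult [of g f] by auto
    then obtain v where "p \<le> Poly_Mapping.lookup b v"
      using f unfolding monom_ideal_def by auto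
    then show "\<exists>b. p \<le> Poly_Mapping.lookup m b"
      by (intro exI [of _ v]) (simp add: m lookup_add)
  qed
qed (simp add: monom_ideal_def)

lemma C_ker_imp_monom_ideal:
  assumes "f \<in> C_ker p U"
  shows "poly_eval lin f \<in> monom_ideal"
proof -
  have "C_ker p U \<subseteq> {f \<in> carrier (poly_ring U). poly_eval lin f \<in> monom_ideal}"
  proof (rule C_ker_minimal)
    show "sym_rels U \<subseteq> {f \<in> carrier (poly_ring U). poly_eval lin f \<in> monom_ideal}"
    proof
      fix f assume f: "f \<in> sym_rels U"
      have "poly_eval lin f = 0"
        using f by (auto simp: sym_rels_def poly_eval_diff poly_eval_add poly_eval_mult lin_add lin_scale Const_def)
      then show "f \<in> {f \<in> carrier (poly_ring U). poly_eval lin f \<in> monom_ideal}"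
        using f sym_rels_carrier monom_ideal_closed(1) by auto
    qed
    fix u assume u: "u \<in> U"
    \<comment> \<open>Additivity of p-th powers leaves only pure powers of basis variables. Hence
      the relations for all vectors of \<open>U\<close> impose nothing beyond those for the
      basis.\<close>
    have "lin u ^ p = (\<Sum>b\<in>B. (Const (coord u b) * Var b) ^ p)"
      unfolding lin_def
      by (rule freshmans_dream_sum) (simp_all add: CHAR_poly_mapping char_k prime_char)
    also have "\<dots> = (\<Sum>b\<in>B. Const (coord u b) ^ p * Poly_Mapping.single (Poly_Mapping.single b p) 1)"
      by (simp add: power_mult_distrib Var_power)
    also have "\<dots> \<in> monom_ideal"
    proof -
      have "Poly_Mapping.single (Poly_Mapping.single b p) 1 \<in> monom_ideal" for b
        by (auto simp: monom_ideal_def intro: exI [of _ b])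
      then have "(\<Sum>b\<in>F. Const (coord u b) ^ p * Poly_Mapping.single (Poly_Mapping.single b p) 1) \<in> monom_ideal" for F
        by (induction F rule: infinite_finite_induct) (simp_all add: monom_ideal_closed)
      then show ?thesis .
    qed
    finally show "Var u ^ p \<in> {f \<in> carrier (poly_ring U). poly_eval lin f \<in> monom_ideal}"
      using u by (simp add: poly_eval_power poly_ring_power)
  qed (auto simp: poly_eval_add poly_eval_mult monom_ideal_closed)
  then show ?thesis using assms by auto
qed

text \<open>The substitution fixes the basis variables, so the socle stays a single monomial, and
  its exponents are at most \<open>p - 1\<close>.\<close>

lemma socle_not_in_C_ker: "socle \<notin> C_ker p U"
proof
  assume "socle \<in> C_ker p U"
  then have "poly_eval lin socle \<in> monom_ideal"
    by (rule C_ker_imp_monom_ideal)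
  moreover have "poly_eval lin (\<Prod>b\<in>F. Var b ^ (p - 1)) = (\<Prod>b\<in>F. lin b ^ (p - 1))" for F
    by (induction F rule: infinite_finite_induct) (simp_all add: poly_eval_mult poly_eval_power)
  moreover have "(\<Prod>b\<in>F. lin b ^ (p - 1)) =
      Poly_Mapping.single (\<Sum>b\<in>F. Poly_Mapping.single b (p - 1)) 1" if "F \<subseteq> B" for F
    using that
    by (induction F rule: infinite_finite_induct) (simp_all add: lin_basis Var_power mult_single)
  ultimately obtain b where "p \<le> Poly_Mapping.lookup (\<Sum>b\<in>B. Poly_Mapping.single b (p - 1)) b"
    by (auto simp: socle_def monom_ideal_def)
  also have "\<dots> \<le> p - 1"
    using finite_B by (auto simp: lookup_sum lookup_single when_def)
  finally show False using p_gt_0 by simp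
qed

lemma C_ker_trunc:
  assumes f: "f \<in> carrier (poly_ring U)"
  obtains q where "Poly_Mapping.keys q \<subseteq> trunc_monoms" "f - q \<in> C_ker p U"
proof -
  define g where "g = poly_eval lin f"
  let ?K = "Poly_Mapping.keys g" and ?t = "\<lambda>m. Poly_Mapping.single m (Poly_Mapping.lookup g m)"
  define q where "q = (\<Sum>m\<in>?K \<inter> trunc_monoms. ?t m)"
  have "g = (\<Sum>m\<in>?K. ?t m)"
    by (rule poly_mapping_sum_single)
  also have "\<dots> = q + (\<Sum>m\<in>?K - trunc_monoms. ?t m)"
    unfolding q_def by (subst sum.union_disjoint [symmetric]) (auto simp: Int_Diff_Un)
  finally have gq: "g - q = (\<Sum>m\<in>?K - trunc_monoms. ?t m)"
    by (metis add_diff_cancel_left')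
  have "g - q \<in> C_ker p U"
    unfolding gq
  proof (rule C_ker_sum)
    fix m assume m: "m \<in> ?K - trunc_monoms"
    then have mB: "Poly_Mapping.keys m \<subseteq> B"
      using poly_eval_lin_closed [of f] by (auto simp: g_def poly_ring_carrier_iff)
    then obtain b where b: "p \<le> Poly_Mapping.lookup m b"
      using m by (auto simp: trunc_monoms_def not_less)
    then have "b \<in> Poly_Mapping.keys m"
      using p_gt_0 by (simp add: in_keys_iff)
    then have bU: "b \<in> U" using mB B_subset_U by auto
    \<comment> \<open>The subtraction of exponents is truncated; it is exact here because
      \<open>b\<close> has exponent at least \<open>p\<close>.\<close>
    define m' where "m' = m - Poly_Mapping.single b p"
    have mm': "m = m' + Poly_Mapping.single b p"
      by (rule poly_mapping_eqI) (use b in \<open>auto simp: m'_def lookup_add lookup_minus lookup_single when_def\<close>)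
    have m'U: "Poly_Mapping.keys m' \<subseteq> U"
    proof
      fix x assume "x \<in> Poly_Mapping.keys m'"
      then have "x \<in> Poly_Mapping.keys m"
        by (auto simp: mm' in_keys_iff lookup_add)
      then show "x \<in> U" using mB B_subset_U by auto
    qed
    have "?t m = Poly_Mapping.single m' (Poly_Mapping.lookup g m) * Var b ^ p"
      unfolding Var_power by (simp add: mult_single flip: mm')
    also have "\<dots> \<in> C_ker p U"
      using bU m'U by (intro C_ker_mult Var_power_in_C_ker) (auto simp: poly_ring_carrier_iff)
    finally show "?t m \<in> C_ker p U" .
  qed
  then have "f - q \<in> C_ker p U"
    using C_ker_add [OF minus_poly_eval_lin_in_C_ker [OF f]] by (fastforce simp: g_def)
  moreover have "Poly_Mapping.keys q \<subseteq> trunc_monoms"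
    unfolding q_def by (auto simp: in_keys_iff lookup_sum lookup_single when_def split: if_splits
      dest!: sum.not_neutral_contains_not_neutral)
  ultimately show thesis using that by blast
qed

lemma trunc_closed:
  "Poly_Mapping.keys q \<subseteq> trunc_monoms \<Longrightarrow> q \<in> carrier (poly_ring U)"
  using B_subset_U by (auto simp: poly_ring_carrier_iff trunc_monoms_def)

text \<open>This makes \<open>alpha\<close> well defined: polynomials of value zero form an ideal
  containing the linear relations, and the p-th powers because \<open>u ^ p = 0\<close> on
  \<open>U\<close>.\<close>

lemma eval_poly_C_ker:
  assumes "f \<in> C_ker p U"
  shows "eval_poly f = 0"
proof -
  have "C_ker p U \<subseteq> {f \<in> carrier (poly_ring U). eval_poly f = 0}"
  proof (rule C_ker_minimal)
    show "sym_rels U \<subseteq> {f \<in> carrier (poly_ring U). eval_poly f = 0}"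
      using sym_rels_carrier
      by (auto simp: sym_rels_def eval_poly_eq poly_eval_diff poly_eval_add poly_eval_mult gscale_def scalar_def)
  qed (auto simp: eval_poly_eq poly_eval_add poly_eval_mult poly_eval_power poly_ring_power nilpotent_U)
  then show ?thesis using assms by auto
qed

lemma alpha_C_proj:
  assumes f: "f \<in> carrier (poly_ring U)"
  shows "alpha (C_proj p U f) = eval_poly f"
proof -
  have "eval_poly g = eval_poly f" if "g \<in> \<Union> (C_proj p U f)" for g
  proof -
    have "g - f \<in> C_ker p U"
      using that f C_proj_eq_iff [of g f] by (simp add: Union_C_proj)
    then show ?thesis
      using eval_poly_C_ker by (fastforce simp: eval_poly_eq poly_eval_diff)
  qed
  moreover have "f \<in> \<Union> (C_proj p U f)"
    using f by (simp add: Union_C_proj)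
  ultimately have "eval_poly ` \<Union> (C_proj p U f) = {eval_poly f}"
    by blast
  then show ?thesis by (simp add: alpha_def)
qed

lemma eval_poly_socle: "eval_poly socle = (\<Prod>b\<in>B. b ^ (p - 1))"
proof -
  have "eval_poly (\<Prod>b\<in>F. Var b ^ (p - 1)) = (\<Prod>b\<in>F. b ^ (p - 1))" for F
    unfolding eval_poly_eq
    by (induction F rule: infinite_finite_induct) (simp_all add: poly_eval_mult poly_eval_power)
  then show ?thesis by (simp add: socle_def)
qed

lemma socle_times_Var: "b \<in> B \<Longrightarrow> socle * Var b \<in> C_ker p U"
proof -
  assume b: "b \<in> B"
  have "socle * Var b = (\<Prod>b\<in>B - {b}. Var b ^ (p - 1)) * Var b ^ p"
    unfolding socle_def prod.remove [OF finite_B b]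
    by (simp only: power_minus_mult [OF p_gt_0, symmetric] mult_ac)
  also have "\<dots> \<in> C_ker p U"
    using b B_subset_U by (intro C_ker_mult Var_power_in_C_ker poly_ring_prod poly_ring_power) auto
  finally show ?thesis .
qed

lemma monom_split:
  fixes m :: "'a \<Rightarrow>\<^sub>0 nat"
  assumes "m \<noteq> 0"
  obtains b m' where "b \<in> Poly_Mapping.keys m" "Poly_Mapping.keys m' \<subseteq> Poly_Mapping.keys m"
    "m = Poly_Mapping.single b 1 + m'"
proof -
  obtain b where b: "Poly_Mapping.lookup m b \<noteq> 0"
    using assms poly_mapping_eqI [of m 0] by auto
  define m' where "m' = m - Poly_Mapping.single b 1"
  have "m = Poly_Mapping.single b 1 + m'"
    by (rule poly_mapping_eqI) (use b in \<open>auto simp: m'_def lookup_add lookup_minus lookup_single when_def\<close>)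
  moreover from this have "Poly_Mapping.keys m' \<subseteq> Poly_Mapping.keys m"
    by (metis UnCI add_eq_0_iff_both_eq_0 in_keys_iff lookup_add subsetI)
  ultimately show thesis
    using b that by (simp add: in_keys_iff)
qed

text \<open>The socle kills every monomial of positive degree, so only the constant term of
  \<open>q\<close> survives the product. If that were nonzero, dividing by it would put the socle
  itself into the kernel.\<close>

lemma socle_times_trunc:
  assumes q: "Poly_Mapping.keys q \<subseteq> trunc_monoms" and s: "socle * q \<in> C_ker p U"
  shows "Poly_Mapping.lookup q 0 = 0"
proof (rule ccontr)
  let ?c = "Poly_Mapping.lookup q 0"
  assume c: "?c \<noteq> 0"
  have "socle * Poly_Mapping.single m (Poly_Mapping.lookup q m) \<in> C_ker p U"
    if m: "m \<in> Poly_Mapping.keys q - {0}" for m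
  proof -
    obtain b m' where b: "b \<in> Poly_Mapping.keys m" "Poly_Mapping.keys m' \<subseteq> Poly_Mapping.keys m"
      "m = Poly_Mapping.single b 1 + m'"
      using monom_split m by blast
    have mB: "Poly_Mapping.keys m \<subseteq> B"
      using m q by (auto simp: trunc_monoms_def)
    have "socle * Poly_Mapping.single m (Poly_Mapping.lookup q m) =
        Poly_Mapping.single m' (Poly_Mapping.lookup q m) * (socle * Var b)"
      unfolding b(3) Var_def by (simp add: mult_single mult_ac)
    also have "\<dots> \<in> C_ker p U"
      using b mB B_subset_U by (intro C_ker_mult socle_times_Var) (auto simp: poly_ring_carrier_iff)
    finally show ?thesis .
  qed
  then have "(\<Sum>m\<in>Poly_Mapping.keys q - {0}. socle * Poly_Mapping.single m (Poly_Mapping.lookup q m))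
      \<in> C_ker p U"
    by (rule C_ker_sum)
  moreover have "socle * q = socle * Const ?c +
      (\<Sum>m\<in>Poly_Mapping.keys q - {0}. socle * Poly_Mapping.single m (Poly_Mapping.lookup q m))"
    using c
    by (subst (1) poly_mapping_sum_single [of q], subst sum.remove [of _ 0])
      (simp_all add: in_keys_iff distrib_left sum_distrib_left Const_def)
  ultimately have "socle * Const ?c \<in> C_ker p U"
    using C_ker_add [OF s C_ker_minus] by fastforce
  then have "Const (inverse ?c) * (socle * Const ?c) \<in> C_ker p U"
    by (rule C_ker_mult) simp
  moreover have "Const (inverse ?c) * (socle * Const ?c) = socle * Const (inverse ?c * ?c)"
    by (simp add: Const_mult mult_ac)
  ultimately show False
    using c socle_not_in_C_ker by (simp add: Const_1)
qed

end

section \<open>Freeness over the truncated symmetric algebra\<close>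

text \<open>\<open>D\<close> lifts a basis of the quotient by \<open>R\<close>, expressed without a
  quotient space: it is what is added when a basis of \<open>R\<close> is extended to the whole
  space.\<close>

lemma (in vector_space) complement_basis:
  assumes R: "subspace R"
  obtains D where "\<And>x. \<exists>y\<in>span D. x - y \<in> R"
    and "\<And>F a. finite F \<Longrightarrow> F \<subseteq> D \<Longrightarrow> (\<Sum>d\<in>F. a d *s d) \<in> R \<Longrightarrow> (\<forall>d\<in>F. a d = 0)"
proof -
  obtain B0 where B0: "B0 \<subseteq> R" "independent B0" "R \<subseteq> span B0"
    by (metis basis_exists [of R])
  have sB0: "span B0 = R"
    using span_minimal [OF B0(1) R] B0(3) by auto
  obtain B1 where B1: "B0 \<subseteq> B1" "independent B1" "span B1 = UNIV"
    by (metis maximal_independent_subset_extend [OF subset_UNIV B0(2)] top.extremum_uniqueI)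
  define D where "D = B1 - B0"
  show thesis
  proof
    fix x
    have "x \<in> span (D \<union> B0)"
      using B1 by (simp add: D_def Un_absorb2)
    then obtain y z where "y \<in> span D" "z \<in> span B0" "x = y + z"
      unfolding span_Un by auto
    then show "\<exists>y\<in>span D. x - y \<in> R"
      using sB0 by (intro bexI [of _ y]) auto
  next
    fix F a
    assume F: "finite F" "F \<subseteq> D" and s: "(\<Sum>d\<in>F. a d *s d) \<in> R"
    obtain t r where t: "finite t" "t \<subseteq> B0" "(\<Sum>d\<in>F. a d *s d) = (\<Sum>b\<in>t. r b *s b)"
      using s unfolding sB0 [symmetric] span_explicit by auto
    have disj: "F \<inter> t = {}" using F t by (auto simp: D_def)
    \<comment> \<open>Moving the expansion in \<open>B0\<close> to the other side gives a relation
      among the vectors of \<open>B1\<close>.\<close>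
    define c where "c d = (if d \<in> F then a d else - r d)" for d
    have "(\<Sum>d\<in>F \<union> t. c d *s d) = (\<Sum>d\<in>F. c d *s d) + (\<Sum>d\<in>t. c d *s d)"
      using F t disj by (intro sum.union_disjoint) auto
    also have "(\<Sum>d\<in>F. c d *s d) = (\<Sum>d\<in>F. a d *s d)"
      by (simp add: c_def)
    also have "(\<Sum>d\<in>t. c d *s d) = (\<Sum>d\<in>t. - (r d *s d))"
      using disj by (intro sum.cong) (auto simp: c_def)
    finally have "(\<Sum>d\<in>F \<union> t. c d *s d) = 0"
      by (simp add: t(3) sum_negf)
    then have "c d = 0" if "d \<in> F \<union> t" for d
      using independentD [OF B1(2), of "F \<union> t" c d] F t B1(1) that by (auto simp: D_def)
    then show "\<forall>d\<in>F. a d = 0"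
      unfolding c_def by (metis UnI1)
  qed
qed

lemma (in module_char_p) rad_subI: "finite I \<Longrightarrow> i \<in> I \<Longrightarrow> u i *s m \<in> rad_sub u I"
  unfolding rad_sub_def
  by (rule image_eqI [of _ _ "\<lambda>j. if j = i then m else 0"])
    (simp_all add: if_distrib [of "\<lambda>x. _ *s x"] sum.delta' cong: if_cong)

lemma scalar_add: "scalar (a + b) = scalar a + scalar b"
  by (simp add: scalar_def single_add)

lemma scalar_mult: "scalar (a * b) = scalar a * scalar b"
  by (simp add: scalar_def mult_single)

lemma scalar_0 [simp]: "scalar 0 = 0" and scalar_1 [simp]: "scalar 1 = 1"
  by (simp_all add: scalar_def)

lemma finsum_restriction:
  assumes "finite F"
  shows "finsum (restriction act) f F = sum f F"
proof -
  interpret abelian_monoid "restriction act"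
    by (rule abelian_monoidI) (simp_all add: restriction_def add_ac)
  have carrier: "carrier (restriction act) = UNIV" by (simp add: restriction_def)
  show ?thesis
    using assms
  proof (induction F rule: finite_induct)
    case empty
    then show ?case by (subst finsum_empty) (simp add: restriction_def)
  next
    case (insert x F)
    then show ?case
      by (subst finsum_insert) (auto simp: carrier, simp add: restriction_def)
  qed
qed

locale truncated_sym_module = truncated_sym_basis U p B + M: module_char_p act p
  for U :: "('e::ab_group_add, 'k::field) group_algebra set" and p B
    and act :: "('e, 'k) group_algebra \<Rightarrow> 'm::ab_group_add \<Rightarrow> 'm"
begin

sublocale vs: vector_space "\<lambda>c. act (scalar c)"
  by unfold_locales
    (simp_all add: M.scale_right_distrib scalar_add M.scale_left_distrib scalar_mult)

abbreviation "rad_M \<equiv> M.rad_sub (\<lambda>b. b) B"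

abbreviation degree :: "(('e, 'k) group_algebra \<Rightarrow>\<^sub>0 nat) \<Rightarrow> nat" where
  "degree m \<equiv> (\<Sum>b\<in>B. Poly_Mapping.lookup m b)"

abbreviation mon :: "(('e, 'k) group_algebra \<Rightarrow>\<^sub>0 nat) \<Rightarrow> ('e, 'k) group_algebra" where
  "mon \<equiv> monom_eval (\<lambda>b. b)"

lemma eval_poly_trunc:
  "eval_poly q = (\<Sum>m\<in>Poly_Mapping.keys q. scalar (Poly_Mapping.lookup q m) * mon m)"
  by (simp add: eval_poly_eq poly_eval_def scalar_def)

lemma mon_act_rad_M:
  assumes "m \<noteq> 0" "Poly_Mapping.keys m \<subseteq> B"
  shows "act (y * mon m) x \<in> rad_M"
proof -
  obtain b m' where "b \<in> Poly_Mapping.keys m" "m = Poly_Mapping.single b 1 + m'"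
    using monom_split [OF assms(1)] by blast
  then have "act (y * mon m) x = act b (act (y * mon m') x)" and "b \<in> B"
    using assms(2) by (auto simp: monom_eval_add mult_ac)
  then show ?thesis
    using M.rad_subI [OF finite_B, of b "\<lambda>b. b" "act (y * mon m') x"] by (simp only:)
qed

text \<open>The coefficients in \<open>C p U\<close> are given by polynomials \<open>g d\<close> representing them.\<close>
definition comb :: "'m set \<Rightarrow> ('m \<Rightarrow> (('e, 'k) group_algebra, 'k) mpoly) \<Rightarrow> 'm" where
  "comb F g = (\<Sum>d\<in>F. act (eval_poly (g d)) d)"

text \<open>\<open>F\<close> may be larger than the support, since zero coefficients act as zero;
  this allows two coefficient families to be compared over a common finite set.\<close>

lemma comb_coeffs:
  assumes F: "finite F" "F \<subseteq> D" and c: "c \<in> D \<rightarrow>\<^sub>E carrier (C p U)"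
    and supp: "{d \<in> D. c d \<noteq> \<zero>\<^bsub>C p U\<^esub>} \<subseteq> F"
    and g: "\<And>d. d \<in> F \<Longrightarrow> g d \<in> carrier (poly_ring U) \<and> C_proj p U (g d) = c d"
  shows "(\<Oplus>\<^bsub>restriction act\<^esub>d\<in>{d \<in> D. c d \<noteq> \<zero>\<^bsub>C p U\<^esub>}. c d \<odot>\<^bsub>restriction act\<^esub> d) = comb F g"
proof -
  have ag: "alpha (c d) = eval_poly (g d)" if "d \<in> F" for d
    using alpha_C_proj g [OF that] by metis
  have "alpha \<zero>\<^bsub>C p U\<^esub> = 0"
    using alpha_C_proj [of 0] by (simp add: C_proj_0 eval_poly_eq)
  then have "eval_poly (g d) = 0" if "d \<in> F" "c d = \<zero>\<^bsub>C p U\<^esub>" for d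
    using ag [OF that(1)] that(2) by simp
  then have "comb F g = (\<Sum>d\<in>{d \<in> D. c d \<noteq> \<zero>\<^bsub>C p U\<^esub>}. act (alpha (c d)) d)"
    unfolding comb_def using F supp ag by (intro sum.mono_neutral_cong_right) auto
  moreover have "finite {d \<in> D. c d \<noteq> \<zero>\<^bsub>C p U\<^esub>}"
    using supp F(1) by (rule finite_subset)
  ultimately show ?thesis
    by (simp add: finsum_restriction) (simp add: restriction_def)
qed

lemma C_representatives:
  assumes c: "c \<in> D \<rightarrow>\<^sub>E carrier (C p U)"
  shows "\<exists>f. \<forall>d\<in>D. f d \<in> carrier (poly_ring U) \<and> C_proj p U (f d) = c d"
proof (rule bchoice, rule ballI)
  fix d assume "d \<in> D"
  then show "\<exists>f. f \<in> carrier (poly_ring U) \<and> C_proj p U f = c d"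
    using PiE_mem [OF c] unfolding C_carrier by (metis imageE)
qed

text \<open>Expand \<open>x\<close> in a free basis with truncated representatives
  \<open>q d\<close>. If the socle kills \<open>x\<close>, uniqueness forces
  \<open>socle * q d\<close> into the kernel, so \<open>q d\<close> has no constant term, and every
  other monomial maps into the radical of the module.\<close>

lemma free_imp_socle_exact:
  assumes free: "free_module (C p U) (restriction act)"
  shows "M.socle_exact (\<lambda>b. b) B"
  unfolding M.socle_exact_def
proof (intro allI impI)
  fix x assume x: "act (\<Prod>b\<in>B. b ^ (p - 1)) x = 0"
  let ?supp = "\<lambda>D c. {d \<in> D. c d \<noteq> \<zero>\<^bsub>C p U\<^esub>}"
  obtain D where D: "\<And>x. \<exists>!c. c \<in> D \<rightarrow>\<^sub>E carrier (C p U) \<and> finite (?supp D c) \<and>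
      x = (\<Oplus>\<^bsub>restriction act\<^esub>d\<in>?supp D c. c d \<odot>\<^bsub>restriction act\<^esub> d)"
    using free unfolding free_module_def by (auto simp: restriction_def)
  interpret A: cring "C p U" by (rule cring_C)
  obtain c where c: "c \<in> D \<rightarrow>\<^sub>E carrier (C p U)" "finite (?supp D c)"
    "x = (\<Oplus>\<^bsub>restriction act\<^esub>d\<in>?supp D c. c d \<odot>\<^bsub>restriction act\<^esub> d)"
    using D [of x] by blast
  from C_representatives [OF c(1)] obtain f
    where "\<forall>d\<in>D. f d \<in> carrier (poly_ring U) \<and> C_proj p U (f d) = c d" ..
  note f = this [rule_format]
  have "\<exists>q. Poly_Mapping.keys q \<subseteq> trunc_monoms \<and> f d - q \<in> C_ker p U" if "d \<in> D" for d
    using C_ker_trunc f that by metis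
  then obtain q where q: "\<And>d. d \<in> D \<Longrightarrow> Poly_Mapping.keys (q d) \<subseteq> trunc_monoms \<and> f d - q d \<in> C_ker p U"
    by metis
  have qc: "q d \<in> carrier (poly_ring U) \<and> C_proj p U (q d) = c d" if "d \<in> D" for d
    using q [OF that] f [OF that] trunc_closed C_proj_eq_iff by metis
  let ?F = "?supp D c"
  have xq: "x = comb ?F q"
    unfolding c(3) by (rule comb_coeffs) (use c qc in auto)
  \<comment> \<open>These are the coefficients of the socle times \<open>x\<close>, which is
    0.\<close>
  define c' where "c' = restrict (\<lambda>d. C_proj p U (socle * q d)) D"
  have c': "c' \<in> D \<rightarrow>\<^sub>E carrier (C p U)"
    unfolding c'_def restrict_PiE_iff using qc socle_closed by auto
  have supp': "?supp D c' \<subseteq> ?F"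
    using qc by (auto simp: c'_def C_proj_mult socle_closed)
  have "(\<Oplus>\<^bsub>restriction act\<^esub>d\<in>?supp D c'. c' d \<odot>\<^bsub>restriction act\<^esub> d) = comb ?F (\<lambda>d. socle * q d)"
    using c(2) c' supp' qc socle_closed by (intro comb_coeffs) (auto simp: c'_def)
  also have "\<dots> = act (eval_poly socle) (comb ?F q)"
    unfolding comb_def by (simp add: M.scale_sum_right eval_poly_eq poly_eval_mult)
  also have "\<dots> = 0"
    using x xq by (simp add: eval_poly_socle)
  finally have r': "0 = (\<Oplus>\<^bsub>restriction act\<^esub>d\<in>?supp D c'. c' d \<odot>\<^bsub>restriction act\<^esub> d)" ..
  \<comment> \<open>The competing expansion of 0. Both families are restricted to \<open>D\<close>
    because uniqueness only concerns extensional functions.\<close>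
  define c0 where "c0 = restrict (\<lambda>d. \<zero>\<^bsub>C p U\<^esub>) D"
  have c0: "c0 \<in> D \<rightarrow>\<^sub>E carrier (C p U)"
    unfolding c0_def restrict_PiE_iff by auto
  have supp0: "?supp D c0 = {}" by (auto simp: c0_def)
  have r0: "0 = (\<Oplus>\<^bsub>restriction act\<^esub>d\<in>?supp D c0. c0 d \<odot>\<^bsub>restriction act\<^esub> d)"
    unfolding supp0 by (simp add: finsum_restriction)
  have "finite (?supp D c')" using supp' c(2) by (rule finite_subset)
  then have "c' = c0"
    using D [of 0] c' r' c0 r0 supp0 by (metis (no_types, lifting) finite.emptyI)
  then have "C_proj p U (socle * q d) = \<zero>\<^bsub>C p U\<^esub>" if "d \<in> D" for d
    using that unfolding c'_def c0_def by (metis (no_types, lifting) restrict_apply')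
  then have "socle * q d \<in> C_ker p U" if "d \<in> D" for d
    using that qc socle_closed by (simp add: C_ker_def)
  then have q0: "Poly_Mapping.lookup (q d) 0 = 0" if "d \<in> D" for d
    using socle_times_trunc q that by blast
  have "act (eval_poly (q d)) d \<in> rad_M" if d: "d \<in> D" for d
    unfolding eval_poly_trunc M.scale_sum_left
  proof (rule M.subspace_sum [OF M.subspace_rad_sub], rule mon_act_rad_M)
    fix m assume "m \<in> Poly_Mapping.keys (q d)"
    then show "m \<noteq> 0" "Poly_Mapping.keys m \<subseteq> B"
      using q0 [OF d] q [OF d] by (auto simp: in_keys_iff trunc_monoms_def)
  qed
  then show "x \<in> rad_M"
    unfolding xq comb_def by (intro M.subspace_sum [OF M.subspace_rad_sub]) auto
qed

text \<open>
  Multiplying by a suitable monomial moves the coefficients of a monomial of least degree into the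
  socle and kills all others.
\<close>
lemma comb_eq_0_imp_C_ker:
  assumes ex: "M.socle_exact (\<lambda>b. b) B" and F: "finite F"
    and indep: "\<And>a. (\<Sum>d\<in>F. act (scalar (a d)) d) \<in> rad_M \<Longrightarrow> (\<forall>d\<in>F. a d = 0)"
    and g: "\<And>d. d \<in> F \<Longrightarrow> g d \<in> carrier (poly_ring U)" and 0: "comb F g = 0"
    and d: "d \<in> F"
  shows "g d \<in> C_ker p U"
proof -
  have "\<exists>q. Poly_Mapping.keys q \<subseteq> trunc_monoms \<and> g d - q \<in> C_ker p U" if "d \<in> F" for d
    using C_ker_trunc g that by metis
  then obtain q where q: "\<And>d. d \<in> F \<Longrightarrow> Poly_Mapping.keys (q d) \<subseteq> trunc_monoms \<and> g d - q d \<in> C_ker p U"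
    by metis
  have "eval_poly (g d) = eval_poly (q d)" if "d \<in> F" for d
    using eval_poly_C_ker [of "g d - q d"] q [OF that] by (simp add: eval_poly_eq poly_eval_diff)
  then have q0: "comb F q = 0"
    using 0 by (simp add: comb_def)
  have "q d = 0" if d: "d \<in> F" for d
  proof (rule ccontr)
    assume "q d \<noteq> 0"
    then have ex0: "\<exists>m. m \<in> (\<Union>d\<in>F. Poly_Mapping.keys (q d))"
      using d by (metis UN_I keys_eq_empty all_not_in_conv)
    \<comment> \<open>The minimum is taken over all coefficients together, so that one multiplier
      serves every \<open>d\<close>.\<close>
    define m0 where "m0 = arg_min degree (\<lambda>m. m \<in> (\<Union>d\<in>F. Poly_Mapping.keys (q d)))"
    have m0: "m0 \<in> (\<Union>d\<in>F. Poly_Mapping.keys (q d))"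
      and least: "\<And>m. m \<in> (\<Union>d\<in>F. Poly_Mapping.keys (q d)) \<Longrightarrow> degree m0 \<le> degree m"
      using arg_min_nat_lemma [of "\<lambda>m. m \<in> (\<Union>d\<in>F. Poly_Mapping.keys (q d))" _ degree] ex0
      unfolding m0_def by blast+
    define s where "s = (\<Prod>b\<in>B. b ^ (p - 1))"
    \<comment> \<open>The complementary monomial, raising each exponent of \<open>m0\<close> to
      \<open>p - 1\<close>.\<close>
    define z where "z = (\<Prod>b\<in>B. b ^ (p - 1 - Poly_Mapping.lookup m0 b))"
    have m0_trunc: "m0 \<in> trunc_monoms" using m0 q by auto
    have zmon: "z * mon m = (\<Prod>b\<in>B. b ^ (p - 1 - Poly_Mapping.lookup m0 b + Poly_Mapping.lookup m b))"
      if "m \<in> trunc_monoms" for m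
      using that finite_B
      by (simp add: z_def monom_eval_superset [of B] trunc_monoms_def power_add prod.distrib)
    have z0: "z * mon m0 = s"
      unfolding zmon [OF m0_trunc] s_def
      using m0_trunc by (intro prod.cong refl arg_cong [of _ _ "\<lambda>n. _ ^ n"])
        (auto simp: trunc_monoms_def Suc_le_eq intro!: le_add_diff_inverse2 dest: spec)
    have zm: "z * mon m = 0" if m: "m \<in> Poly_Mapping.keys (q d)" "d \<in> F" "m \<noteq> m0" for m d
    proof -
      have mt: "m \<in> trunc_monoms" using q m by auto
      \<comment> \<open>A monomial different from \<open>m0\<close> and of no smaller degree exceeds
        it in some variable; multiplication by \<open>z\<close> then brings that exponent to at
        least \<open>p\<close>.\<close>
      have "\<exists>b\<in>B. Poly_Mapping.lookup m0 b < Poly_Mapping.lookup m b"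
      proof (rule ccontr)
        assume "\<not> ?thesis"
        then have le: "\<And>b. b \<in> B \<Longrightarrow> Poly_Mapping.lookup m b \<le> Poly_Mapping.lookup m0 b"
          by (auto simp: not_less)
        have "degree m = degree m0"
          using least [of m] m sum_mono [of B, OF le] by fastforce
        then have "Poly_Mapping.lookup m b = Poly_Mapping.lookup m0 b" if "b \<in> B" for b
          using sum_mono_inv [of "Poly_Mapping.lookup m" B "Poly_Mapping.lookup m0" b] le that finite_B by blast
        moreover have "Poly_Mapping.lookup m b = Poly_Mapping.lookup m0 b" if "b \<notin> B" for b
          using mt m0_trunc that by (metis (no_types, lifting) in_keys_iff mem_Collect_eq subsetD trunc_monoms_def)
        ultimately have "m = m0"
          by (intro poly_mapping_eqI) blast
        then show False using m by simp
      qed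
      then obtain b where b: "b \<in> B" "Poly_Mapping.lookup m0 b < Poly_Mapping.lookup m b" by blast
      have "p \<le> p - 1 - Poly_Mapping.lookup m0 b + Poly_Mapping.lookup m b"
        using b(2) by linarith
      then have "b ^ (p - 1 - Poly_Mapping.lookup m0 b + Poly_Mapping.lookup m b) = 0"
        using nilpotent_U [of b] b(1) B_subset_U
        by (metis le_iff_add mult_zero_left power_add subsetD)
      then show ?thesis
        unfolding zmon [OF mt] using finite_B b(1) by (auto intro!: prod_zero)
    qed
    have zq: "z * eval_poly (q d) = s * scalar (Poly_Mapping.lookup (q d) m0)" if d: "d \<in> F" for d
    proof -
      have "z * eval_poly (q d) =
          (\<Sum>m\<in>Poly_Mapping.keys (q d). scalar (Poly_Mapping.lookup (q d) m) * (z * mon m))"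
        by (simp add: eval_poly_trunc sum_distrib_left mult_ac)
      also have "\<dots> = (\<Sum>m\<in>Poly_Mapping.keys (q d).
          if m = m0 then scalar (Poly_Mapping.lookup (q d) m0) * s else 0)"
        using zm z0 d by (intro sum.cong refl) auto
      also have "\<dots> = s * scalar (Poly_Mapping.lookup (q d) m0)"
        by (simp add: sum.delta' mult.commute in_keys_iff)
      finally show ?thesis .
    qed
    \<comment> \<open>After multiplication by \<open>z\<close> only the \<open>m0\<close>
      coefficients remain, multiplied by the socle. The criterion moves their combination into the
      radical, where independence makes them all zero.\<close>
    have "act s (\<Sum>d\<in>F. act (scalar (Poly_Mapping.lookup (q d) m0)) d) = act z (comb F q)"
      unfolding comb_def M.scale_sum_right by (intro sum.cong refl) (simp add: zq)
    also have "\<dots> = 0" using q0 by simp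
    finally have "(\<Sum>d\<in>F. act (scalar (Poly_Mapping.lookup (q d) m0)) d) \<in> rad_M"
      using ex unfolding M.socle_exact_def s_def by blast
    then have "\<forall>d\<in>F. Poly_Mapping.lookup (q d) m0 = 0"
      by (rule indep)
    then show False using m0 by (auto simp: in_keys_iff)
  qed
  then show ?thesis using q [OF d] d by auto
qed

text \<open>Monomials of large degree vanish, and degrees are lowered one at a time.\<close>
lemma nakayama:
  assumes Y: "\<And>x y. x \<in> Y \<Longrightarrow> y \<in> Y \<Longrightarrow> x + y \<in> Y" "0 \<in> Y"
    and Y_act: "\<And>m x. x \<in> Y \<Longrightarrow> Poly_Mapping.keys m \<subseteq> B \<Longrightarrow> act (mon m) x \<in> Y"
    and gen: "\<And>x. \<exists>y\<in>Y. x - y \<in> rad_M"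
  shows "x \<in> Y"
proof -
  \<comment> \<open>Exponents below \<open>p\<close> give degree at most \<open>card B * p\<close>,
    so degree \<open>T\<close> forces some exponent to be at least \<open>p\<close>.\<close>
  define T where "T = Suc (card B * p)"
  \<comment> \<open>\<open>N\<close> measures how far the degree may fall below \<open>T\<close>. At
    \<open>N = T\<close> the monomial 1 is allowed, which is the claim for \<open>x\<close>
    itself.\<close>
  have "act (mon m) x \<in> Y" if "Poly_Mapping.keys m \<subseteq> B" "T - N \<le> degree m" "N \<le> T" for N m x
    using that
  proof (induction N arbitrary: m x)
    case 0
    have "\<exists>b\<in>B. p \<le> Poly_Mapping.lookup m b"
    proof (rule ccontr)
      assume "\<not> ?thesis"
      then have "degree m \<le> (\<Sum>b\<in>B. p)"
        by (intro sum_mono) auto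
      then show False using 0 by (simp add: T_def)
    qed
    then obtain b where b: "b \<in> B" "p \<le> Poly_Mapping.lookup m b" by blast
    then have "b ^ Poly_Mapping.lookup m b = 0"
      using nilpotent_U [of b] B_subset_U
      by (metis le_iff_add mult_zero_left power_add subsetD)
    then have "mon m = 0"
      using finite_B b(1) 0 by (auto simp: monom_eval_superset [of B] intro!: prod_zero)
    then show ?case using Y by simp
  next
    case (Suc N)
    obtain y where y: "y \<in> Y" "x - y \<in> rad_M" using gen by blast
    then obtain l where l: "x - y = (\<Sum>b\<in>B. act b (l b))"
      unfolding M.rad_sub_def by auto
    have "act (mon m) x = act (mon m) y + act (mon m) (x - y)"
      by (simp flip: M.scale_right_distrib)
    also have "act (mon m) (x - y) = (\<Sum>b\<in>B. act (mon (m + Poly_Mapping.single b 1)) (l b))"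
      by (simp add: l M.scale_sum_right monom_eval_add)
    finally have eq: "act (mon m) x = act (mon m) y +
        (\<Sum>b\<in>B. act (mon (m + Poly_Mapping.single b 1)) (l b))" .
    have "act (mon (m + Poly_Mapping.single b 1)) (l b) \<in> Y" if b: "b \<in> B" for b
    proof (rule Suc.IH)
      show "Poly_Mapping.keys (m + Poly_Mapping.single b 1) \<subseteq> B"
        using Suc.prems b keys_add [of m "Poly_Mapping.single b 1"] by auto
      have "degree (m + Poly_Mapping.single b 1) = Suc (degree m)"
        using finite_B b by (simp add: lookup_add sum.distrib lookup_single when_def sum.delta)
      then show "T - N \<le> degree (m + Poly_Mapping.single b 1)"
        using Suc.prems by linarith
    qed (use Suc.prems in simp)
    then have "(\<Sum>b\<in>B'. act (mon (m + Poly_Mapping.single b 1)) (l b)) \<in> Y" if "B' \<subseteq> B" for B'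
      using that Y by (induction B' rule: infinite_finite_induct) auto
    then show ?case
      unfolding eq using Y Y_act [OF y(1)] Suc.prems by blast
  qed
  from this [of 0 T x] show ?thesis by simp
qed

text \<open>A lift \<open>D\<close> of a basis modulo the radical is a free basis: it generates by
  the Nakayama argument, and its coefficients are unique by the comparison of terms of least
  degree.\<close>

lemma socle_exact_imp_free:
  assumes ex: "M.socle_exact (\<lambda>b. b) B"
  shows "free_module (C p U) (restriction act)"
proof -
  interpret A: cring "C p U" by (rule cring_C)
  have sub: "vs.subspace rad_M"
    using M.subspace_rad_sub [of "\<lambda>b. b" B]
    by (intro vs.subspaceI) (auto simp: M.subspace_0 M.subspace_add M.subspace_scale)
  show ?thesis
  proof (rule vs.complement_basis [OF sub])
    fix D
    assume gen: "\<And>x. \<exists>y\<in>vs.span D. x - y \<in> rad_M"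
      and indep: "\<And>F a. finite F \<Longrightarrow> F \<subseteq> D \<Longrightarrow> (\<Sum>d\<in>F. act (scalar (a d)) d) \<in> rad_M
        \<Longrightarrow> (\<forall>d\<in>F. a d = 0)"
  \<comment> \<open>The submodule over \<open>C p U\<close> generated by \<open>D\<close>, described
    by polynomial coefficients.\<close>
  define Y where "Y = {comb F g | F g. finite F \<and> F \<subseteq> D \<and> (\<forall>d. g d \<in> carrier (poly_ring U))}"
  have comb_superset: "comb F g = comb F' (\<lambda>d. if d \<in> F then g d else 0)" if "finite F'" "F \<subseteq> F'" for F F' g
    unfolding comb_def using that by (intro sum.mono_neutral_cong_left) (auto simp: eval_poly_eq)
  have Y_add: "x + y \<in> Y" if xy: "x \<in> Y" "y \<in> Y" for x y
  proof -
    obtain F g where 1: "x = comb F g" "finite F" "F \<subseteq> D" "\<And>d. g d \<in> carrier (poly_ring U)"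
      using xy(1) unfolding Y_def by blast
    obtain F' g' where 2: "y = comb F' g'" "finite F'" "F' \<subseteq> D" "\<And>d. g' d \<in> carrier (poly_ring U)"
      using xy(2) unfolding Y_def by blast
    let ?h = "\<lambda>d. (if d \<in> F then g d else 0) + (if d \<in> F' then g' d else 0)"
    have "x + y = comb (F \<union> F') ?h"
      unfolding 1(1) 2(1)
      by (subst (1) comb_superset [of "F \<union> F'"], use 1 2 in simp, use 1 2 in simp,
          subst (2) comb_superset [of "F \<union> F'"], use 1 2 in simp, use 1 2 in simp,
          unfold comb_def eval_poly_eq poly_eval_add M.scale_left_distrib sum.distrib, rule refl)
    then show ?thesis
      unfolding Y_def using 1 2 by (intro CollectI exI [of _ "F \<union> F'"] exI [of _ ?h]) auto
  qed
  have Y_act: "act (eval_poly f) x \<in> Y" if f: "f \<in> carrier (poly_ring U)" and x: "x \<in> Y" for f x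
  proof -
    obtain F g where 1: "x = comb F g" "finite F" "F \<subseteq> D" "\<And>d. g d \<in> carrier (poly_ring U)"
      using x unfolding Y_def by blast
    have "act (eval_poly f) x = comb F (\<lambda>d. f * g d)"
      unfolding 1(1) comb_def by (simp add: M.scale_sum_right eval_poly_eq poly_eval_mult)
    then show ?thesis
      unfolding Y_def using 1 f by (intro CollectI exI [of _ F] exI [of _ "\<lambda>d. f * g d"]) auto
  qed
  have Y_0: "0 \<in> Y"
    unfolding Y_def by (intro CollectI exI [of _ "{}"] exI [of _ "\<lambda>_. 0"]) (auto simp: comb_def)
  have Y_D: "d \<in> Y" if "d \<in> D" for d
    unfolding Y_def using that
    by (intro CollectI exI [of _ "{d}"] exI [of _ "\<lambda>_. 1"]) (auto simp: comb_def eval_poly_eq)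
  have Y_scalar: "act (scalar c) x \<in> Y" if "x \<in> Y" for c x
    using Y_act [OF Const_in_poly_ring [of c] that] by (simp add: eval_poly_eq scalar_def)
  have "vs.span D \<subseteq> Y"
    using Y_0 Y_add Y_scalar Y_D by (intro vs.span_minimal vs.subspaceI) auto
  then have gen': "\<exists>y\<in>Y. x - y \<in> rad_M" for x
    using gen [of x] by blast
  have Y_mon: "act (mon m) x \<in> Y" if "x \<in> Y" "Poly_Mapping.keys m \<subseteq> B" for m x
    using Y_act [of "Poly_Mapping.single m 1" x] that B_subset_U
    by (auto simp: eval_poly_eq poly_ring_carrier_iff)
  have Y_all: "x \<in> Y" for x
    by (rule nakayama) (use Y_add Y_0 Y_mon gen' in auto)
  let ?supp = "\<lambda>c. {d \<in> D. c d \<noteq> \<zero>\<^bsub>C p U\<^esub>}"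
  have "\<exists>!c. c \<in> D \<rightarrow>\<^sub>E carrier (C p U) \<and> finite (?supp c) \<and>
      x = (\<Oplus>\<^bsub>restriction act\<^esub>d\<in>?supp c. c d \<odot>\<^bsub>restriction act\<^esub> d)" for x
  proof (rule ex_ex1I)
    obtain F g where 1: "x = comb F g" "finite F" "F \<subseteq> D" "\<And>d. g d \<in> carrier (poly_ring U)"
      using Y_all [of x] unfolding Y_def by blast
    define c where "c = restrict (\<lambda>d. if d \<in> F then C_proj p U (g d) else \<zero>\<^bsub>C p U\<^esub>) D"
    have c: "c \<in> D \<rightarrow>\<^sub>E carrier (C p U)"
      unfolding c_def restrict_PiE_iff using 1(4) by auto
    have supp: "?supp c \<subseteq> F" by (auto simp: c_def split: if_splits)
    have "x = (\<Oplus>\<^bsub>restriction act\<^esub>d\<in>?supp c. c d \<odot>\<^bsub>restriction act\<^esub> d)"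
      unfolding 1(1) using 1 c supp by (intro comb_coeffs [symmetric]) (auto simp: c_def)
    then show "\<exists>c. c \<in> D \<rightarrow>\<^sub>E carrier (C p U) \<and> finite (?supp c) \<and>
        x = (\<Oplus>\<^bsub>restriction act\<^esub>d\<in>?supp c. c d \<odot>\<^bsub>restriction act\<^esub> d)"
      using c finite_subset [OF supp 1(2)] by blast
  next
    fix c c'
    assume c: "c \<in> D \<rightarrow>\<^sub>E carrier (C p U) \<and> finite (?supp c) \<and>
        x = (\<Oplus>\<^bsub>restriction act\<^esub>d\<in>?supp c. c d \<odot>\<^bsub>restriction act\<^esub> d)"
      and c': "c' \<in> D \<rightarrow>\<^sub>E carrier (C p U) \<and> finite (?supp c') \<and>
        x = (\<Oplus>\<^bsub>restriction act\<^esub>d\<in>?supp c'. c' d \<odot>\<^bsub>restriction act\<^esub> d)"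
    \<comment> \<open>Both expansions are written over the union of their supports, so that their
      difference is a single relation.\<close>
    let ?F = "?supp c \<union> ?supp c'"
    from C_representatives [OF conjunct1 [OF c]] obtain f
      where "\<forall>d\<in>D. f d \<in> carrier (poly_ring U) \<and> C_proj p U (f d) = c d" ..
    note f = this [rule_format]
    from C_representatives [OF conjunct1 [OF c']] obtain f'
      where "\<forall>d\<in>D. f' d \<in> carrier (poly_ring U) \<and> C_proj p U (f' d) = c' d" ..
    note f' = this [rule_format]
    have F: "finite ?F" "?F \<subseteq> D" using c c' by auto
    have "x = comb ?F f"
      using c f F comb_coeffs [of ?F D c f] by auto
    moreover have "x = comb ?F f'"
      using c' f' F comb_coeffs [of ?F D c' f'] by auto
    ultimately have 0: "comb ?F (\<lambda>d. f d - f' d) = 0"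
      by (simp add: comb_def eval_poly_eq poly_eval_diff M.scale_left_diff_distrib sum_subtractf)
    have "f d - f' d \<in> C_ker p U" if "d \<in> ?F" for d
      by (rule comb_eq_0_imp_C_ker [OF ex F(1) indep [OF F] _ 0 that]) (use f f' F in auto)
    then have "c d = c' d" if "d \<in> ?F" for d
      using that f [of d] f' [of d] C_proj_eq_iff [of "f d" "f' d"] by auto
    then have "c d = c' d" if "d \<in> D" for d
      using that by (cases "d \<in> ?F") auto
    then show "c = c'"
      using c c' by (meson PiE_ext)
  qed
  then show ?thesis
    unfolding free_module_def by (intro exI [of _ D]) (simp add: restriction_def)
  qed
qed

end

section \<open>The radical of the group algebra\<close>

context
  fixes p n :: nat
  assumes char_k: "CHAR('k::field) = p" and p_pos: "p > 0"
    and elementary: "elementary_abelian TYPE('e::ab_group_add) p n"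
begin

lemma prime_p: "Factorial_Ring.prime p"
  using prime_CHAR_semidom [where 'a = 'k] char_k p_pos by simp

lemma elementary_abelian_torsion:
  fixes g :: 'e
  shows "((+) g ^^ p) 0 = 0"
proof -
  let ?G = "\<lparr>carrier = (UNIV :: 'e set), monoid.mult = (+), monoid.one = 0\<rparr>"
  let ?H = "product_group {..<n} (\<lambda>_. integer_mod_group p)"
  obtain h where h: "h \<in> Group.iso ?G ?H"
    using elementary unfolding elementary_abelian_def is_iso_def by blast
  then have hom: "h (a + b) = (\<lambda>i\<in>{..<n}. (h a i + h b i) mod int p)"
    and carrier: "h a \<in> (\<Pi>\<^sub>E i\<in>{..<n}. {0..<int p})" and inj: "inj h" for a b
    using p_pos by (auto simp: Group.iso_def hom_def bij_betw_def product_group_def Pi_iff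
        integer_mod_group_def carrier_integer_mod_group)
  \<comment> \<open>The count starts at one summand: the base case then only says that the
    coordinates of \<open>h g\<close> are already reduced, and the value \<open>h 0\<close> is not
    involved.\<close>
  have q: "h (((+) g ^^ Suc m) 0) = (\<lambda>i\<in>{..<n}. (int (Suc m) * h g i) mod int p)" for m
  proof (induction m)
    case 0
    show ?case
      using carrier [of g] by (auto simp: PiE_iff extensional_def fun_eq_iff)
  next
    case (Suc m)
    have "h (((+) g ^^ Suc (Suc m)) 0) = h (g + ((+) g ^^ Suc m) 0)" by simp
    also have "\<dots> = (\<lambda>i\<in>{..<n}. (int (Suc (Suc m)) * h g i) mod int p)"
      unfolding hom Suc.IH by (intro restrict_ext) (simp add: mod_add_right_eq algebra_simps)
    finally show ?case .
  qed
  define x where "x = ((+) g ^^ p) 0"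
  have "h x = (\<lambda>i\<in>{..<n}. 0)"
    using q [of "p - 1"] p_pos by (simp add: x_def cong: restrict_cong)
  \<comment> \<open>Injectivity of \<open>h\<close> will give \<open>x + x = x\<close>, again
    without computing \<open>h 0\<close>.\<close>
  then have "h (x + x) = h x"
    by (simp add: hom cong: restrict_cong)
  then have "x + x = x"
    using inj by (simp add: inj_eq)
  then show ?thesis by (simp add: x_def)
qed

text \<open>By additivity of p-th powers it suffices to treat single group elements, and these
  become the identity because the group has exponent dividing \<open>p\<close>.\<close>

lemma group_algebra_power_p:
  fixes x :: "('e, 'k) group_algebra"
  shows "\<exists>c. x ^ p = scalar c"
proof -
  have s: "Poly_Mapping.single g c ^ m = Poly_Mapping.single (((+) g ^^ m) 0) (c ^ m)"
    for g :: 'e and c :: 'k and m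
    by (induction m) (simp_all add: mult_single)
  have "x ^ p = (\<Sum>g\<in>Poly_Mapping.keys x. Poly_Mapping.single g (Poly_Mapping.lookup x g)) ^ p"
    by (simp flip: poly_mapping_sum_single)
  also have "\<dots> = (\<Sum>g\<in>Poly_Mapping.keys x. Poly_Mapping.single g (Poly_Mapping.lookup x g) ^ p)"
    by (rule freshmans_dream_sum) (simp_all add: CHAR_poly_mapping char_k prime_p)
  also have "\<dots> = (\<Sum>g\<in>Poly_Mapping.keys x. scalar (Poly_Mapping.lookup x g ^ p))"
    by (simp add: s elementary_abelian_torsion scalar_def)
  also have "\<dots> = scalar (\<Sum>g\<in>Poly_Mapping.keys x. Poly_Mapping.lookup x g ^ p)"
  proof -
    have "(\<Sum>g\<in>A. scalar (f g)) = (scalar (sum f A) :: ('e, 'k) group_algebra)" for f and A :: "'e set"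
      by (induction A rule: infinite_finite_induct) (simp_all add: scalar_def single_add)
    then show ?thesis .
  qed
  finally show ?thesis by blast
qed

text \<open>The set of elements with vanishing \<open>p\<close>-th power is the augmentation ideal.\<close>
lemma maximalideal_nilpotent: "maximalideal {x :: ('e, 'k) group_algebra. x ^ p = 0} kE"
proof -
  let ?I = "{x :: ('e, 'k) group_algebra. x ^ p = 0}"
  have add: "(x + y) ^ p = x ^ p + y ^ p" for x y :: "('e, 'k) group_algebra"
    by (rule freshmans_dream) (simp_all add: CHAR_poly_mapping char_k prime_p)
  have minus: "(- x) ^ p = - (x ^ p)" for x :: "('e, 'k) group_algebra"
    using add [of x "- x"] zero_power [OF p_pos] by (metis add.right_inverse add_eq_0_iff)
  have ring: "ring (kE :: ('e, 'k) group_algebra ring)"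
  proof (rule ringI)
    show "abelian_group (kE :: ('e, 'k) group_algebra ring)"
      by (rule abelian_groupI)
        (auto simp: kE_def add_ac intro: exI [of _ "- x" for x] ab_group_add_class.ab_left_minus)
    show "Group.monoid (kE :: ('e, 'k) group_algebra ring)"
      by (rule Group.monoidI) (simp_all add: kE_def mult_ac)
  qed (simp_all add: kE_def algebra_simps)
  interpret R: ring "kE :: ('e, 'k) group_algebra ring" by (rule ring)
  have inv: "inv\<^bsub>add_monoid kE\<^esub> x = - x" for x :: "('e, 'k) group_algebra"
    using R.minus_equality [of "- x" x] by (simp add: a_inv_def kE_def)
  show ?thesis
  proof (rule maximalidealI)
    show "ideal ?I kE"
    proof (rule idealI [OF ring])
      show "subgroup ?I (add_monoid kE)"
      proof
        fix x assume "x \<in> ?I"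
        then show "inv\<^bsub>add_monoid kE\<^esub> x \<in> ?I"
          unfolding inv by (simp add: minus)
      qed (use zero_power [OF p_pos] in \<open>auto simp: kE_def add\<close>)
    qed (auto simp: kE_def power_mult_distrib)
  next
    show "carrier kE \<noteq> ?I"
      using p_pos by (auto simp: kE_def dest: arg_cong [of _ _ "\<lambda>A. 1 \<in> A"])
  next
    fix J :: "('e, 'k) group_algebra set"
    assume J: "ideal J kE" "?I \<subseteq> J" "J \<subseteq> carrier kE"
    interpret J: ideal J kE by (rule J(1))
    have mult: "a * x \<in> J" if "x \<in> J" for a x
      using J.I_l_closed [OF that, of a] by (simp add: kE_def)
    show "J = ?I \<or> J = carrier kE"
    proof (rule disjCI)
      assume "J \<noteq> carrier kE"
      show "J = ?I"
      proof (rule ccontr)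
        assume "J \<noteq> ?I"
        then obtain x where x: "x \<in> J" "x ^ p \<noteq> 0" using J(2) by auto
        obtain c where c: "x ^ p = scalar c" using group_algebra_power_p by blast
        have c0: "c \<noteq> 0" using x(2) c by (auto simp: scalar_def)
        \<comment> \<open>\<open>x ^ p\<close> is a nonzero scalar, so \<open>x\<close> is a unit
          with this explicit inverse, and an ideal containing it is everything.\<close>
        have "scalar (inverse c) * x ^ (p - 1) * x = scalar (inverse c) * scalar c"
          using power_minus_mult [OF p_pos, of x] c by (simp only: mult.assoc)
        also have "\<dots> = 1"
          using c0 by (simp add: scalar_def mult_single)
        finally have "1 \<in> J"
          using mult [OF x(1)] by metis
        then have "J = carrier kE"
          using mult [of 1] by (auto simp: kE_def)
        then show False using \<open>J \<noteq> carrier kE\<close> by simp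
      qed
    qed
  qed
qed

lemma Rad_nilpotent: "(x :: ('e, 'k) group_algebra) \<in> Rad \<Longrightarrow> x ^ p = 0"
  using maximalideal_nilpotent unfolding Rad_def by blast

lemma Rad_0: "(0 :: ('e, 'k) group_algebra) \<in> Rad"
  unfolding Rad_def
proof (rule InterI)
  fix I :: "('e, 'k) group_algebra set"
  assume "I \<in> {I. maximalideal I kE}"
  then interpret maximalideal I kE by simp
  show "0 \<in> I"
    using additive_subgroup.zero_closed [OF additive_subgroup_axioms] by (simp add: kE_def)
qed

lemma proj_eq_imp_Rad2:
  fixes x y :: "('e, 'k) group_algebra"
  assumes "proj y = proj x"
  obtains h where "h \<in> Rad2" "y = x + h"
proof -
  \<comment> \<open>\<open>ideal_prod\<close> is generated inductively by products and sums, so its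
    zero has to be produced as a product.\<close>
  have "0 * 0 \<in> (Rad2 :: ('e, 'k) group_algebra set)"
    using ideal_prod.prod [OF Rad_0 Rad_0, of kE] by (simp add: Rad2_def kE_def)
  then have "y \<in> proj y"
    by (force simp: proj_def a_r_coset_def' kE_def)
  then have "y \<in> proj x" using assms by simp
  then show thesis
    using that by (force simp: proj_def a_r_coset_def' kE_def add.commute)
qed

text \<open>An element of \<open>Rad2\<close> is built by sums from products of two radical
  elements, each an admissible perturbation. The operator \<open>x\<close> is kept arbitrary in the
  induction since it changes with every summand.\<close>

lemma exact_mod_add_Rad2:
  fixes act :: "('e, 'k) group_algebra \<Rightarrow> 'm::ab_group_add \<Rightarrow> 'm"
  assumes "module_char_p act p" and h: "h \<in> Rad2" and J: "module.subspace act J"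
    and ex: "module_char_p.exact_mod act p J x"
  shows "module_char_p.exact_mod act p J (x + h)"
proof -
  interpret M: module_char_p act p by fact
  show ?thesis
    using h ex unfolding Rad2_def
  proof (induction arbitrary: x rule: ideal_prod.induct)
    case (prod i j)
    then show ?case
      using M.exact_mod_perturb [OF J, of x j i p] Rad_nilpotent by (simp add: kE_def)
  next
    case (sum s1 s2)
    then have "M.exact_mod J (x + s1 + s2)" by blast
    then show ?case by (simp add: kE_def add.assoc)
  qed
qed

end

section \<open>Transport of Grassmannians\<close>

definition linear_iso ::
  "('e::ab_group_add, 'k::field) group_algebra set \<Rightarrow> ('e, 'k) group_algebra set
     \<Rightarrow> (('e, 'k) group_algebra \<Rightarrow> ('e, 'k) group_algebra) \<Rightarrow> bool" where
  "linear_iso V W \<psi> \<longleftrightarrow> module.subspace gscale V \<and> module.subspace gscale W \<and>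
     linear_map_on V gscale gscale \<psi> \<and> bij_betw \<psi> V W"

context
  fixes V W :: "('e::ab_group_add, 'k::field) group_algebra set" and \<psi>
  assumes iso: "linear_iso V W \<psi>"
begin

interpretation gs: vector_space "gscale :: 'k \<Rightarrow> ('e, 'k) group_algebra \<Rightarrow> _"
  by (rule vector_space_gscale)

interpretation gp: vector_space_pair "gscale :: 'k \<Rightarrow> ('e, 'k) group_algebra \<Rightarrow> _"
  "gscale :: 'k \<Rightarrow> ('e, 'k) group_algebra \<Rightarrow> _" ..

lemma iso_facts:
  shows "gs.subspace V" "gs.subspace W" "linear_map_on V gscale gscale \<psi>" "bij_betw \<psi> V W"
    and "inj_on \<psi> V" "\<psi> ` V = W"
  using iso by (auto simp: linear_iso_def bij_betw_def)

lemma iso_inv_into: "v \<in> V \<Longrightarrow> inv_into V \<psi> (\<psi> v) = v" "w \<in> W \<Longrightarrow> \<psi> (inv_into V \<psi> w) = w"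
  using iso_facts by (auto simp: f_inv_into_f)

lemma iso_inv_image:
  shows "U \<subseteq> V \<Longrightarrow> inv_into V \<psi> ` \<psi> ` U = U"
    and "U' \<subseteq> W \<Longrightarrow> \<psi> ` inv_into V \<psi> ` U' = U'"
proof -
  show "inv_into V \<psi> ` \<psi> ` U = U" if "U \<subseteq> V"
    using that iso_inv_into by (force simp: image_image)
  show "\<psi> ` inv_into V \<psi> ` U' = U'" if "U' \<subseteq> W"
    using that iso_inv_into by (force simp: image_image)
qed

lemma linear_iso_inv: "linear_iso W V (inv_into V \<psi>)"
proof -
  let ?\<chi> = "inv_into V \<psi>"
  have bij: "bij_betw ?\<chi> W V" using iso_facts by (intro bij_betw_inv_into)
  have in_V: "?\<chi> w \<in> V" if "w \<in> W" for w using bij that by (rule bij_betwE [rule_format])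
  have 1: "?\<chi> (x + y) = ?\<chi> x + ?\<chi> y" if "x \<in> W" "y \<in> W" for x y
  proof -
    have "?\<chi> x + ?\<chi> y \<in> V" using in_V that iso_facts(1) gs.subspace_add by blast
    moreover have "\<psi> (?\<chi> x + ?\<chi> y) = x + y"
      using iso_facts(3) in_V that iso_inv_into unfolding linear_map_on_def by simp
    ultimately show ?thesis using iso_inv_into(1) by metis
  qed
  have 2: "?\<chi> (gscale c x) = gscale c (?\<chi> x)" if "x \<in> W" for c x
  proof -
    have "gscale c (?\<chi> x) \<in> V" using in_V that iso_facts(1) gs.subspace_scale by blast
    moreover have "\<psi> (gscale c (?\<chi> x)) = gscale c x"
      using iso_facts(3) in_V that iso_inv_into unfolding linear_map_on_def by simp
    ultimately show ?thesis using iso_inv_into(1) by metis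
  qed
  show ?thesis
    using 1 2 bij iso_facts by (simp add: linear_iso_def linear_map_on_def)
qed

text \<open>\<open>\<psi>\<close> is linear on \<open>V\<close> only. It is replaced by a linear map
  \<open>\<Phi>\<close> of the whole space, extended from a basis of \<open>V\<close>, to which the
  facts on spans and independence apply.\<close>

lemma linear_iso_independent_span:
  assumes B: "B \<subseteq> V" "\<not> gs.dependent B"
  shows "\<not> gs.dependent (\<psi> ` B)" "gs.span (\<psi> ` B) = \<psi> ` gs.span B"
proof -
  obtain b where b: "b \<subseteq> V" "\<not> gs.dependent b" "V \<subseteq> gs.span b"
    by (metis gs.basis_exists)
  obtain \<Phi> where \<Phi>: "Vector_Spaces.linear gscale gscale \<Phi>" "\<forall>x\<in>b. \<Phi> x = \<psi> x"
    using gp.linear_independent_extend [OF b(2)] by blast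
  interpret \<Phi>: Vector_Spaces.linear gscale gscale \<Phi> by (rule \<Phi>(1))
  have "\<psi> (gscale 0 0) = gscale 0 (\<psi> 0)"
    using iso_facts(3) gs.subspace_0 [OF iso_facts(1)] unfolding linear_map_on_def by blast
  then have "\<psi> 0 = 0" by simp
  then have "gs.subspace {x \<in> V. \<Phi> x = \<psi> x}"
    using iso_facts(1,3) unfolding linear_map_on_def
    by (intro gs.subspaceI) (auto simp: gs.subspace_0 gs.subspace_add gs.subspace_scale \<Phi>.add \<Phi>.scale)
  then have "gs.span b \<subseteq> {x \<in> V. \<Phi> x = \<psi> x}"
    using b(1) \<Phi>(2) by (intro gs.span_minimal) auto
  then have eq: "\<Phi> x = \<psi> x" if "x \<in> V" for x
    using b(3) that by auto
  have sV: "gs.span B \<subseteq> V"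
    using B(1) iso_facts(1) by (rule gs.span_minimal)
  have im: "\<psi> ` B = \<Phi> ` B" "\<psi> ` gs.span B = \<Phi> ` gs.span B"
    using eq B(1) sV by (auto intro!: image_cong)
  have "inj_on \<Phi> (gs.span B)"
    using inj_on_subset [OF iso_facts(5) sV] eq sV by (metis inj_on_cong subsetD)
  then show "\<not> gs.dependent (\<psi> ` B)"
    unfolding im by (rule gp.linear_independent_injective_image [OF \<Phi>(1) B(2)])
  show "gs.span (\<psi> ` B) = \<psi> ` gs.span B"
    unfolding im by (rule gp.linear_span_image [OF \<Phi>(1)])
qed

lemma Grass_image:
  assumes U: "U \<in> Grass r V"
  shows "\<psi> ` U \<in> Grass r W"
proof -
  have UV: "U \<subseteq> V" and Us: "gs.subspace U" and r: "gs.dim U = r"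
    using U by (auto simp: Grass_def)
  obtain B where B: "B \<subseteq> U" "\<not> gs.dependent B" "U \<subseteq> gs.span B" "card B = gs.dim U"
    by (metis gs.basis_exists)
  have sB: "gs.span B = U"
    using B(1,3) Us gs.span_minimal by blast
  note * = linear_iso_independent_span [OF subset_trans [OF B(1) UV] B(2)]
  have "gs.dim (\<psi> ` U) = card (\<psi> ` B)"
    using * by (metis gs.dim_eq_card gs.dim_span sB)
  also have "\<dots> = card B"
    using inj_on_subset [OF iso_facts(5) subset_trans [OF B(1) UV]] by (rule card_image)
  finally have "gs.dim (\<psi> ` U) = r" using B(4) r by simp
  moreover have "gs.subspace (\<psi> ` U)"
    using *(2) sB gs.subspace_span by metis
  ultimately show ?thesis
    using UV iso_facts(6) by (auto simp: Grass_def)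
qed

lemma frame_image:
  assumes fr: "frame r U u" and U: "U \<subseteq> V"
  shows "frame r (\<psi> ` U) (\<psi> \<circ> u)"
proof -
  have u: "u ` {..<r} \<subseteq> V"
    using fr U gs.span_superset [of "u ` {..<r}"] by (simp add: frame_def)
  have "inj_on (\<psi> \<circ> u) {..<r}"
    using fr inj_on_subset [OF iso_facts(5) u] by (auto simp: frame_def intro: comp_inj_on)
  moreover have "(\<psi> \<circ> u) ` {..<r} = \<psi> ` u ` {..<r}"
    by (rule image_comp [symmetric])
  ultimately show ?thesis
    unfolding frame_def using fr linear_iso_independent_span [OF u] by (simp add: frame_def)
qed

text \<open>Functionals on \<open>W\<close> compose with \<open>\<psi>\<close> to functionals on
  \<open>V\<close>, and the defining determinants keep their values.\<close>

lemma plucker_form_pullback: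
  "plucker_form r W d F \<Longrightarrow> plucker_form r V d (\<lambda>u. F (\<psi> \<circ> u))"
proof (induction rule: plucker_form.induct)
  case (const c)
  show ?case by (rule plucker_form.const)
next
  case (add d F G)
  then show ?case by (intro plucker_form.add)
next
  case (coord l d F)
  have "linear_map_on V gscale (*) (\<lambda>v. l i (\<psi> v))" if "i < r" for i
    using coord(1) [OF that] iso_facts(3,6) unfolding linear_map_on_def by auto
  from plucker_form.coord [OF this coord(3)] show ?case by simp
qed

end

section \<open>Topology and regular functions under the induced map\<close>

text \<open>A frame is a function on all naturals but is constrained only below \<open>r\<close>.
  Applying \<open>\<psi>\<close> after its inverse restores a frame only at those indices, and this
  is all that a form can see.\<close>

lemma plucker_form_cong:
  "plucker_form r V d F \<Longrightarrow> (\<And>j. j < r \<Longrightarrow> u j = u' j) \<Longrightarrow> F u = F u'"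
proof (induction rule: plucker_form.induct)
  case (coord l d F)
  have "mat r r (\<lambda>(i, j). l i (u j)) = mat r r (\<lambda>(i, j). l i (u' j))"
    using coord.prems by (intro eq_matI) auto
  then show ?case using coord by simp
qed auto

lemma frame_exists:
  assumes U: "U \<in> Grass r V" and r: "r \<ge> 1"
  obtains u where "frame r U u"
proof -
  interpret gs: vector_space "gscale :: 'b \<Rightarrow> ('a, 'b) group_algebra \<Rightarrow> _"
    by (rule vector_space_gscale)
  obtain B where B: "B \<subseteq> U" "\<not> gs.dependent B" "U \<subseteq> gs.span B" "card B = gs.dim U"
    by (metis gs.basis_exists)
  have card: "card B = r" using B(4) U by (simp add: Grass_def)
  \<comment> \<open>An infinite set has \<open>card\<close> 0, so \<open>r \<ge> 1\<close> yields
    finiteness.\<close>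
  then have "finite B" using r card.infinite by fastforce
  then obtain u where "bij_betw u {..<r} B"
    using ex_bij_betw_nat_finite [of B] card by (auto simp: lessThan_atLeast0)
  moreover have "gs.span B = U"
    using B(1,3) U gs.span_minimal [of B U] by (auto simp: Grass_def)
  ultimately have "frame r U u"
    using B(2) by (simp add: frame_def bij_betw_def)
  then show thesis by (rule that)
qed

lemma topspace_grass_topology:
  assumes "r \<ge> 1"
  shows "topspace (grass_topology r V) = Grass r V"
proof
  show "topspace (grass_topology r V) \<subseteq> Grass r V"
    by (auto simp: grass_topology_def topology_generated_by_topspace)
  show "Grass r V \<subseteq> topspace (grass_topology r V)"
  proof
    fix U assume U: "U \<in> Grass r V"
    obtain u where "frame r U u" using frame_exists [OF U assms] .
    \<comment> \<open>The constant form 1 of degree 0 is nonzero on every frame, so its basic open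
      set is the whole Grassmannian once frames exist.\<close>
    then have "U \<in> {U \<in> Grass r V. \<exists>u. frame r U u \<and> (\<lambda>_. 1) u \<noteq> (0 :: 'b)}"
      using U by auto
    then show "U \<in> topspace (grass_topology r V)"
      unfolding grass_topology_def topology_generated_by_topspace
      using plucker_form.const [of r V 1] by blast
  qed
qed

text \<open>The preimage of the basic open set of a form is the basic open set of the pulled-back
  form.\<close>

lemma continuous_map_grass_image:
  assumes iso: "linear_iso V W \<psi>" and r: "r \<ge> 1"
  shows "continuous_map (grass_topology r V) (grass_topology r W) ((`) \<psi>)"
proof -
  let ?O = "\<lambda>V F. {U \<in> Grass r V. \<exists>u. frame r U u \<and> F u \<noteq> 0}"
  have preimage: "((`) \<psi>) -` ?O W F \<inter> Grass r V = ?O V (\<lambda>u. F (\<psi> \<circ> u))" if F: "plucker_form r W d F" for d F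
  proof (intro equalityI subsetI)
    fix U assume "U \<in> ((`) \<psi>) -` ?O W F \<inter> Grass r V"
    then obtain u where U: "U \<in> Grass r V" "\<psi> ` U \<in> Grass r W"
      and u: "frame r (\<psi> ` U) u" "F u \<noteq> 0" by auto
    have UV: "U \<subseteq> V" "\<psi> ` U \<subseteq> W" using U by (auto simp: Grass_def)
    let ?v = "inv_into V \<psi> \<circ> u"
    have "frame r U ?v"
      using frame_image [OF linear_iso_inv [OF iso] u(1) UV(2)] iso_inv_image(1) [OF iso UV(1)] by simp
    moreover have "F (\<psi> \<circ> ?v) = F u"
    proof (rule plucker_form_cong [OF F])
      interpret gs: vector_space "gscale :: 'b \<Rightarrow> ('a, 'b) group_algebra \<Rightarrow> _"
        by (rule vector_space_gscale)
      fix j assume "j < r"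
      then have "u j \<in> u ` {..<r}" by simp
      then have "u j \<in> W"
        using u(1) UV(2) gs.span_superset [of "u ` {..<r}"] unfolding frame_def by blast
      then show "(\<psi> \<circ> ?v) j = u j" using iso_inv_into(2) [OF iso] by simp
    qed
    ultimately show "U \<in> ?O V (\<lambda>u. F (\<psi> \<circ> u))"
      using U(1) u(2) by auto
  next
    fix U assume "U \<in> ?O V (\<lambda>u. F (\<psi> \<circ> u))"
    then obtain u where U: "U \<in> Grass r V" and u: "frame r U u" "F (\<psi> \<circ> u) \<noteq> 0" by auto
    have "U \<subseteq> V" using U by (auto simp: Grass_def)
    then show "U \<in> ((`) \<psi>) -` ?O W F \<inter> Grass r V"
      using U u frame_image [OF iso u(1)] Grass_image [OF iso U] by auto
  qed
  have "openin (grass_topology r V) (((`) \<psi>) -` N \<inter> Grass r V)"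
    if N: "N \<in> {?O W F | d F. plucker_form r W d F}" for N
  proof -
    obtain d F where F: "N = ?O W F" "plucker_form r W d F"
      using N by auto
    show ?thesis
      unfolding F(1) preimage [OF F(2)] grass_topology_def
      using plucker_form_pullback [OF iso F(2)]
      by (intro topology_generated_by_Basis CollectI exI [of _ d] exI [of _ "\<lambda>u. F (\<psi> \<circ> u)"]) simp
  qed
  moreover have "((`) \<psi>) ` Grass r V \<subseteq> \<Union> {?O W F | d F. plucker_form r W d F}"
    using Grass_image [OF iso] topspace_grass_topology [OF r, of W]
    unfolding grass_topology_def topology_generated_by_topspace by blast
  ultimately show ?thesis
    unfolding grass_topology_def [of r W] continuous_on_generated_topo_iff topspace_grass_topology [OF r]
    by blast
qed

lemma regular_onE:
  assumes "regular_on r V A S f" "U \<in> S"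
  obtains N d F G where "openin (subtopology (grass_topology r V) A) N" "U \<in> N" "N \<subseteq> S"
    "plucker_form r V d F" "plucker_form r V d G"
    "\<forall>U'\<in>N. \<forall>u. frame r U' u \<longrightarrow> G u \<noteq> 0 \<and> f U' = F u / G u"
  using bspec [OF assms(1) [unfolded regular_on_def] assms(2)]
  by (elim exE conjE) (rule that)

lemma regular_on_pullback:
  assumes iso: "linear_iso V W \<psi>" and r: "r \<ge> 1" and A: "A \<subseteq> Grass r V" "((`) \<psi>) ` A \<subseteq> B"
    and f: "regular_on r W B S f"
  shows "regular_on r V A {U \<in> A. \<psi> ` U \<in> S} (\<lambda>U. f (\<psi> ` U))"
  unfolding regular_on_def
proof (rule ballI)
  fix U assume "U \<in> {U \<in> A. \<psi> ` U \<in> S}"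
  then have U: "U \<in> A" "\<psi> ` U \<in> S" by auto
  obtain N d F G where N: "openin (subtopology (grass_topology r W) B) N" "\<psi> ` U \<in> N" "N \<subseteq> S"
    and FG: "plucker_form r W d F" "plucker_form r W d G"
    and quot: "\<forall>U'\<in>N. \<forall>u. frame r U' u \<longrightarrow> G u \<noteq> 0 \<and> f U' = F u / G u"
    by (rule regular_onE [OF f U(2)])
  let ?N = "{U \<in> A. \<psi> ` U \<in> N}"
  have "continuous_map (subtopology (grass_topology r V) A) (subtopology (grass_topology r W) B) ((`) \<psi>)"
    using continuous_map_grass_image [OF iso r] A(2)
    by (auto simp: continuous_map_in_subtopology continuous_map_from_subtopology)
  from openin_continuous_map_preimage [OF this N(1)]
  have "openin (subtopology (grass_topology r V) A) ?N"
    using A(1) by (simp add: topspace_grass_topology [OF r] Int_absorb1)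
  moreover have "G (\<psi> \<circ> u) \<noteq> 0 \<and> f (\<psi> ` U') = F (\<psi> \<circ> u) / G (\<psi> \<circ> u)"
    if "U' \<in> ?N" "frame r U' u" for U' u
    using that A(1) quot frame_image [OF iso that(2)] by (auto simp: Grass_def)
  ultimately show "\<exists>N d F G. openin (subtopology (grass_topology r V) A) N \<and> U \<in> N \<and>
      N \<subseteq> {U \<in> A. \<psi> ` U \<in> S} \<and> plucker_form r V d F \<and> plucker_form r V d G \<and>
      (\<forall>U'\<in>N. \<forall>u. frame r U' u \<longrightarrow> G u \<noteq> 0 \<and> f (\<psi> ` U') = F u / G u)"
    using U N(2,3) plucker_form_pullback [OF iso FG(1)] plucker_form_pullback [OF iso FG(2)]
    by (intro exI [of _ ?N] exI [of _ d] exI [of _ "\<lambda>u. F (\<psi> \<circ> u)"] exI [of _ "\<lambda>u. G (\<psi> \<circ> u)"]) auto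
qed

lemma regular_on_cong:
  assumes f: "regular_on r V A S f" and eq: "\<And>U. U \<in> S \<Longrightarrow> f U = g U"
  shows "regular_on r V A S g"
  unfolding regular_on_def
proof (rule ballI)
  fix U assume U: "U \<in> S"
  obtain N d F G where N: "openin (subtopology (grass_topology r V) A) N" "U \<in> N" "N \<subseteq> S"
    "plucker_form r V d F" "plucker_form r V d G"
    and quot: "\<forall>U'\<in>N. \<forall>u. frame r U' u \<longrightarrow> G u \<noteq> 0 \<and> f U' = F u / G u"
    by (rule regular_onE [OF f U])
  have "\<forall>U'\<in>N. \<forall>u. frame r U' u \<longrightarrow> G u \<noteq> 0 \<and> g U' = F u / G u"
  proof (intro ballI allI impI)
    fix U' u assume "U' \<in> N" "frame r U' u"
    then show "G u \<noteq> 0 \<and> g U' = F u / G u"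
      using quot eq [of U'] N(3) by auto
  qed
  with N show "\<exists>N d F G. openin (subtopology (grass_topology r V) A) N \<and> U \<in> N \<and>
      N \<subseteq> S \<and> plucker_form r V d F \<and> plucker_form r V d G \<and>
      (\<forall>U'\<in>N. \<forall>u. frame r U' u \<longrightarrow> G u \<noteq> 0 \<and> g U' = F u / G u)"
    by (intro exI [of _ N] exI [of _ d] exI [of _ F] exI [of _ G] conjI)
qed

text \<open>The inverse of \<open>\<psi>\<close> satisfies the same hypotheses with the roles
  exchanged, so continuity and pullback of regular functions in one direction suffice.\<close>

lemma variety_iso_image:
  assumes iso: "linear_iso V W \<psi>" and r: "r \<ge> 1"
    and A: "A \<subseteq> Grass r V" and B: "B \<subseteq> Grass r W"
    and AB: "\<And>U. U \<in> Grass r V \<Longrightarrow> \<psi> ` U \<in> B \<longleftrightarrow> U \<in> A"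
  shows "variety_iso r V A W B ((`) \<psi>)"
proof -
  let ?\<chi> = "inv_into V \<psi>"
  note iso' = linear_iso_inv [OF iso]
  have inv1: "?\<chi> ` \<psi> ` U = U" if "U \<in> Grass r V" for U
    using that iso_inv_image(1) [OF iso, of U] by (simp add: Grass_def)
  have inv2: "\<psi> ` ?\<chi> ` U = U" if "U \<in> Grass r W" for U
    using that iso_inv_image(2) [OF iso, of U] by (simp add: Grass_def)
  have A_B: "((`) \<psi>) ` A \<subseteq> B" using A AB by auto
  have B_A: "((`) ?\<chi>) ` B \<subseteq> A"
  proof (clarify)
    fix U assume U: "U \<in> B"
    then have "?\<chi> ` U \<in> Grass r V" using B Grass_image [OF iso'] by auto
    then show "?\<chi> ` U \<in> A" using AB [of "?\<chi> ` U"] inv2 [of U] U B by auto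
  qed
  have "homeomorphic_maps (subtopology (grass_topology r V) A) (subtopology (grass_topology r W) B)
      ((`) \<psi>) ((`) ?\<chi>)"
    using continuous_map_grass_image [OF iso r] continuous_map_grass_image [OF iso' r] A_B B_A inv1 inv2
    by (auto simp: homeomorphic_maps_def continuous_map_in_subtopology continuous_map_from_subtopology
        topspace_grass_topology [OF r])
  moreover have "regular_on r W B S f \<longleftrightarrow> regular_on r V A {U \<in> A. \<psi> ` U \<in> S} (\<lambda>U. f (\<psi> ` U))"
    if S: "openin (subtopology (grass_topology r W) B) S" for S f
  proof
    assume "regular_on r W B S f"
    then show "regular_on r V A {U \<in> A. \<psi> ` U \<in> S} (\<lambda>U. f (\<psi> ` U))"
      by (rule regular_on_pullback [OF iso r A A_B])
  next
    assume "regular_on r V A {U \<in> A. \<psi> ` U \<in> S} (\<lambda>U. f (\<psi> ` U))"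
    then have reg: "regular_on r W B {U' \<in> B. ?\<chi> ` U' \<in> {U \<in> A. \<psi> ` U \<in> S}} (\<lambda>U'. f (\<psi> ` ?\<chi> ` U'))"
      by (rule regular_on_pullback [OF iso' r B B_A])
    have SB: "S \<subseteq> B" using openin_subset [OF S] by simp
    have "{U' \<in> B. ?\<chi> ` U' \<in> {U \<in> A. \<psi> ` U \<in> S}} = S"
      using SB B B_A inv2 by auto
    \<comment> \<open>The round trip returns \<open>f\<close> only on \<open>S\<close>, so a change
      of representative function is still required.\<close>
    with reg have "regular_on r W B S (\<lambda>U'. f (\<psi> ` ?\<chi> ` U'))" by simp
    then show "regular_on r W B S f"
      by (rule regular_on_cong) (use SB B inv2 in auto)
  qed
  ultimately show ?thesis
    unfolding variety_iso_def homeomorphic_map_maps by blast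
qed

theorem corollary2p10:
  fixes p n r :: nat
    and V W :: "('e::ab_group_add, 'k::alg_closed_field) group_algebra set"
    and \<psi> :: "('e, 'k) group_algebra \<Rightarrow> ('e, 'k) group_algebra"
    and act :: "('e, 'k) group_algebra \<Rightarrow> 'm::ab_group_add \<Rightarrow> 'm"
  assumes "CHAR('k) = p" and "p > 0"
    and "n \<ge> 1" and "elementary_abelian TYPE('e) p n"
    and "splitting V" and "splitting W"
    and "linear_map_on V gscale gscale \<psi>" and "bij_betw \<psi> V W"
    and "\<And>v. v \<in> V \<Longrightarrow> proj (\<psi> v) = proj v"
    and "1 \<le> r" and "r \<le> n"
    and "Modules.module act"
    and "\<exists>B. finite_dimensional_vector_space (\<lambda>c. act (scalar c)) B"
  shows "variety_iso r V (rank_variety p r V act) W (rank_variety p r W act) (\<lambda>U. \<psi> ` U)"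
proof -
  note kE = assms(1,2,4)
  have iso: "linear_iso V W \<psi>"
    using assms(5-8) by (simp add: linear_iso_def splitting_def)
  have prime: "Factorial_Ring.prime p"
    by (rule prime_p [OF kE])
  have M: "module_char_p act p"
  proof -
    interpret Modules.module act by (rule assms(12))
    show ?thesis
      using prime CHAR_poly_mapping [where 'a = 'e and 'b = 'k] assms(1)
        of_nat_CHAR [where 'a = "('e, 'k) group_algebra"]
      by unfold_locales simp_all
  qed
  interpret M: module_char_p act p by (rule M)
  have nilp: "x ^ p = 0" if "x \<in> V \<union> W" for x
    using that assms(5,6) Rad_nilpotent [OF kE] by (auto simp: splitting_def)
  \<comment> \<open>The map of Grassmannians is already an isomorphism; what remains is that it
    matches the two loci.\<close>
  have "free_module (C p (\<psi> ` U)) (restriction act) \<longleftrightarrow> free_module (C p U) (restriction act)"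
    if U: "U \<in> Grass r V" for U
  proof -
    interpret gs: vector_space "gscale :: 'k \<Rightarrow> ('e, 'k) group_algebra \<Rightarrow> _"
      by (rule vector_space_gscale)
    have UV: "U \<subseteq> V" and Us: "gs.subspace U" using U by (auto simp: Grass_def)
    obtain B where B: "B \<subseteq> U" "\<not> gs.dependent B" "U \<subseteq> gs.span B" "card B = gs.dim U"
      by (metis gs.basis_exists)
    have span: "gs.span B = U" using B(1,3) Us gs.span_minimal by blast
    have BV: "B \<subseteq> V" using B(1) UV by blast
    have "card B = r" using B(4) U by (simp add: Grass_def)
    then have fin: "finite B" using assms(10) card.infinite by fastforce
    note image = linear_iso_independent_span [OF iso BV B(2)]
    have \<psi>U: "\<psi> ` U \<in> Grass r W" by (rule Grass_image [OF iso U])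
    interpret U: truncated_sym_module U p B act
      using Us fin B(2) span assms(1) prime nilp UV by unfold_locales auto
    interpret \<psi>U: truncated_sym_module "\<psi> ` U" p "\<psi> ` B" act
      using \<psi>U fin image span assms(1) prime nilp by unfold_locales (auto simp: Grass_def)
    have \<psi>B: "\<psi> b \<in> W" if "b \<in> B" for b
      using that BV iso_facts(6) [OF iso] by auto
    \<comment> \<open>The two vectors agree modulo \<open>Rad2\<close>, so each is the other plus an
      element of \<open>Rad2\<close>, and the perturbation result applies in both
      directions.\<close>
    have "M.exact_mod J (\<psi> b) \<longleftrightarrow> M.exact_mod J b" if b: "b \<in> B" and J: "M.subspace J" for b J
    proof
      have pr: "proj (\<psi> b) = proj b" using assms(9) b BV by auto
      show "M.exact_mod J (\<psi> b)" if "M.exact_mod J b"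
        using proj_eq_imp_Rad2 [OF kE pr] exact_mod_add_Rad2 [OF kE M _ J that] by metis
      show "M.exact_mod J b" if "M.exact_mod J (\<psi> b)"
        using proj_eq_imp_Rad2 [OF kE pr [symmetric]] exact_mod_add_Rad2 [OF kE M _ J that] by metis
    qed
    then have "M.socle_exact \<psi> B \<longleftrightarrow> M.socle_exact (\<lambda>b. b) B"
      using M.socle_exact_perturb [OF fin, of "\<lambda>b. b" \<psi>] M.socle_exact_perturb [OF fin, of \<psi> "\<lambda>b. b"]
        nilp BV \<psi>B by blast
    moreover have "M.socle_exact (\<lambda>b. b) (\<psi> ` B) \<longleftrightarrow> M.socle_exact \<psi> B"
      using M.socle_exact_reindex [of \<psi> B "\<lambda>b. b"] inj_on_subset [OF iso_facts(5) [OF iso] BV]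
      by (simp add: comp_def)
    ultimately show ?thesis
      using U.free_imp_socle_exact U.socle_exact_imp_free
        \<psi>U.free_imp_socle_exact \<psi>U.socle_exact_imp_free by blast
  qed
  then show ?thesis
    using Grass_image [OF iso]
    by (intro variety_iso_image [OF iso assms(10)]) (auto simp: rank_variety_def)
qed

end
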